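(* Let $X,Y$ be real Banach spaces, let $T:X\rightrightarrows X^*$ be a maximal monotone operator of type (D) and let $A:Y\to X$ be a linear continuous map. Then the variational composition $(A^*TA)_v$ is representable.
   Context: Operators are identified with their graphs. For a maximal monotone $T:X\rightrightarrows X^*$, $\widetilde T=\{(x^{**},x^* )\in X^{**}\times X^*: \langle x^{**}-y, x^*-y^*\rangle\ge 0 \text{ for all }(y,y^* )\in T\}$. $T$ is of type (D) if every $(x^{**},x^* )\in\widetilde T$ is the weak$^*\times$strong limit of a bounded net in $T$. A monotone operator $S:Y\rightrightarrows Y^*$ is representable if there is a convex, proper, lower semicontinuous $h:Y\times Y^*\to\mathbb{R}\cup\{+\infty\}$ with $h(y,y^* )\ge\langle y,y^*\rangle$ for all $(y,y^* )$ and $S=\{(y,y^* ): h(y,y^* )=\langle y,y^*\rangle\}$. With $J=\partial\frac12\|\cdot\|^2$, for $T$ of type (D) and $\lambda>0$ the Moreau-Yosida regularization is $T_\lambda=\{(x,x^* ): \exists\, z^{**}\in X^{**} \text{ with } x^*\in\widetilde T(z^{**}),\ 0\in\lambda x^*+\widetilde J(z^{**}-x)\}$. The sequential lower limit of operators $S_n:Y\rightrightarrows Y^*$ is $\liminf S_n=\{(y,y^* ): \exists\,(y_n,y_n^* )\in S_n \text{ with } (y_n,y_n^* )\to(y,y^* ) \text{ in the strong}\times\text{strong topology}\}$. Let $\mathcal{J}=\{(\lambda_n)_n\subset\mathbb{R}: \lambda_n>0,\ \lambda_n\to 0^+\}$. The variational composition is $(A^*TA)_v=\bigcap_{\mathcal{J}}\liminf_n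 A^*T_{\lambda_n}A$. *)

theory Defs
  imports "HOL-Analysis.Analysis"
begin

type_synonym 'a dual = "'a \<Rightarrow>\<^sub>L real"
type_synonym 'a bidual = "('a \<Rightarrow>\<^sub>L real) \<Rightarrow>\<^sub>L real"

text \<open>Operators X to X* are identified with their graphs.\<close>
definition monotone_op :: "('a::real_normed_vector \<times> 'a dual) set \<Rightarrow> bool" where
  "monotone_op T \<longleftrightarrow>
     (\<forall>(x, x') \<in> T. \<forall>(y, y') \<in> T. 0 \<le> blinfun_apply (x' - y') (x - y))"

definition maximal_monotone :: "('a::real_normed_vector \<times> 'a dual) set \<Rightarrow> bool" where
  "maximal_monotone T \<longleftrightarrow> monotone_op T \<and> (\<forall>S. monotone_op S \<and> T \<subseteq> S \<longrightarrow> S = T)"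

definition canon :: "'a::real_normed_vector \<Rightarrow> 'a bidual" where
  "canon x = Blinfun (\<lambda>f. blinfun_apply f x)"

definition tilde_op :: "('a::real_normed_vector \<times> 'a dual) set \<Rightarrow> ('a bidual \<times> 'a dual) set" where
  "tilde_op T = {(z, x'). \<forall>(y, y') \<in> T. 0 \<le> blinfun_apply (z - canon y) (x' - y')}"

text \<open>Type (D): every element of the tilde-extension is the weak*-times-strong limit of a
  bounded net in T. Nets are represented by (proper) filters on X times X*, which is equivalent.\<close>
definition type_D :: "('a::real_normed_vector \<times> 'a dual) set \<Rightarrow> bool" where
  "type_D T \<longleftrightarrow> maximal_monotone T \<and>
     (\<forall>(z, x') \<in> tilde_op T. \<exists>F :: ('a \<times> 'a dual) filter. F \<noteq> bot \<and>
        (\<exists>B. eventually (\<lambda>p. p \<in> T \<and> norm (fst p) \<le> B \<and> norm (snd p) \<le> B) F) \<and>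
        (\<forall>f. ((\<lambda>p. blinfun_apply (canon (fst p)) f) \<longlongrightarrow> blinfun_apply z f) F) \<and>
        (snd \<longlongrightarrow> x') F)"

definition subdiff :: "('a::real_normed_vector \<Rightarrow> real) \<Rightarrow> ('a \<times> 'a dual) set" where
  "subdiff f = {(x, x'). \<forall>y. f x + blinfun_apply x' (y - x) \<le> f y}"

definition duality_map :: "('a::real_normed_vector \<times> 'a dual) set" where
  "duality_map = subdiff (\<lambda>x. (norm x)\<^sup>2 / 2)"

definition yosida :: "('a::real_normed_vector \<times> 'a dual) set \<Rightarrow> real \<Rightarrow> ('a \<times> 'a dual) set" where
  "yosida T l = {(x, x'). \<exists>z. (z, x') \<in> tilde_op T \<and>
                   (z - canon x, - (l *\<^sub>R x')) \<in> tilde_op (duality_map :: ('a \<times> 'a dual) set)}"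

definition comp_op :: "('b::real_normed_vector \<Rightarrow>\<^sub>L 'a::real_normed_vector) \<Rightarrow> ('a \<times> 'a dual) set
    \<Rightarrow> ('b \<times> 'b dual) set" where
  "comp_op A S = {(y, x' o\<^sub>L A) | y x'. (blinfun_apply A y, x') \<in> S}"

definition liminf_op :: "(nat \<Rightarrow> ('b::real_normed_vector \<times> 'b dual) set) \<Rightarrow> ('b \<times> 'b dual) set" where
  "liminf_op S = {(y, y'). \<exists>ys ys'. (\<forall>n. (ys n, ys' n) \<in> S n) \<and> ys \<longlonglongrightarrow> y \<and> ys' \<longlonglongrightarrow> y'}"

definition var_comp :: "('b::real_normed_vector \<Rightarrow>\<^sub>L 'a::real_normed_vector) \<Rightarrow> ('a \<times> 'a dual) set
    \<Rightarrow> ('b \<times> 'b dual) set" where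
  "var_comp A T = \<Inter> {liminf_op (\<lambda>n. comp_op A (yosida T (l n))) | l :: nat \<Rightarrow> real.
                        (\<forall>n. 0 < l n) \<and> l \<longlonglongrightarrow> 0}"

definition ereal_convex :: "('v::real_vector \<Rightarrow> ereal) \<Rightarrow> bool" where
  "ereal_convex h \<longleftrightarrow> (\<forall>u v t. 0 \<le> t \<and> t \<le> 1 \<longrightarrow>
      h (t *\<^sub>R u + (1 - t) *\<^sub>R v) \<le> ereal t * h u + ereal (1 - t) * h v)"

definition lsc_ereal :: "('v::topological_space \<Rightarrow> ereal) \<Rightarrow> bool" where
  "lsc_ereal h \<longleftrightarrow> (\<forall>c::real. closed {p. h p \<le> ereal c})"

definition representable :: "('b::real_normed_vector \<times> 'b dual) set \<Rightarrow> bool" where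
  "representable S \<longleftrightarrow> (\<exists>h :: 'b \<times> 'b dual \<Rightarrow> ereal.
      ereal_convex h \<and> (\<forall>p. h p \<noteq> -\<infinity>) \<and> (\<exists>p. h p \<noteq> \<infinity>) \<and> lsc_ereal h \<and>
      (\<forall>y y'. ereal (blinfun_apply y' y) \<le> h (y, y')) \<and>
      S = {(y, y'). h (y, y') = ereal (blinfun_apply y' y)})"

end

theory Submission
  imports Defs
begin

text \<open>
  For every \<open>l > 0\<close> the operator \<open>S = A* T\<^sub>l A\<close> is represented by a convex lower semicontinuous
  function \<open>\<kappa>\<^sub>l \<ge> \<langle>\<cdot>,\<cdot>\<rangle>\<close> on \<open>Y \<times> Y*\<close>, obtained from the Fitzpatrick function of \<open>T\<close> by Fenchel duality.
  Type (D) enters only through type (NI); it makes \<open>S\<close> quasidense, whence a Broensted-Rockafellar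
  property with constants independent of \<open>l\<close>: if \<open>\<kappa>\<^sub>l(p) \<le> \<langle>p\<rangle> + \<epsilon>\<close>, then \<open>p\<close> is within \<open>8 \<surd>\<epsilon>\<close> of \<open>S\<close>.
  For a sequence \<open>l\<^sub>n \<rightarrow> 0\<close> the lower limit of the epigraphs of \<open>\<kappa>\<close> is closed and convex, and by
  the uniform Broensted-Rockafellar property it touches the pairing exactly on the lower limit of the
  operators.  Intersecting over all sequences gives the epigraph of a representing function.
\<close>

subsection \<open>The Hahn-Banach and sandwich theorems\<close>

text \<open>The quadratic terms of the regularization are finite and continuous everywhere, so the
  sandwich theorem applies whatever the range of \<open>A\<close>, and duality holds exactly. The
  obstacle in the limit is that values approaching the pairing need not come from points of the
  operators. They must be corrected by an amount that does not see \<open>l\<close>: quasidensity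
  measures distances in the norms of \<open>Y\<close> and \<open>Y*\<close> themselves, and the
  iteration built on it uses only convexity, closedness and the lower bound by the pairing. Each
  step divides the defect by 4 and the bound on the displacement by 2, so 8 = 4 * (1 + 1/2 + 1/4 +
  ...). A second obstacle is that the extension of \<open>J\<close> to the bidual is defined through
  monotonicity, while duality yields equality in Young's inequality. The two agree once the range of
  \<open>J\<close> is known to be dense, which follows from the Broensted-Rockafellar property
  itself, applied to a special operator.\<close>

definition sublinear :: "('a::real_vector \<Rightarrow> real) \<Rightarrow> bool" where
  "sublinear p \<longleftrightarrow> (\<forall>x y. p (x + y) \<le> p x + p y) \<and> (\<forall>t x. 0 < t \<longrightarrow> p (t *\<^sub>R x) = t * p x)"

lemma sublinear_zero:
  assumes "sublinear p" shows "p 0 = 0"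
proof -
  have "p (2 *\<^sub>R 0) = 2 * p 0" using assms unfolding sublinear_def by (metis zero_less_numeral)
  then show ?thesis by simp
qed

lemma sublinear_minus:
  assumes "sublinear p" shows "- p (- x) \<le> p x"
proof -
  have "p (x + - x) \<le> p x + p (- x)" using assms unfolding sublinear_def by blast
  then show ?thesis using sublinear_zero[OF assms] by simp
qed

text \<open>Zorn's lemma for the reversed order: a chain is bounded by its pointwise infimum, which
  stays finite because a sublinear \<open>q\<close> below \<open>p\<close> satisfies
  \<open>- p (- x) \<le> q x\<close>.\<close>

lemma minimal_sublinear_exists:
  fixes p :: "'a::real_vector \<Rightarrow> real"
  assumes p: "sublinear p"
  obtains q where "sublinear q" "q \<le> p" "\<And>g. sublinear g \<Longrightarrow> g \<le> q \<Longrightarrow> g = q"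
proof -
  define S where "S = {q. sublinear q \<and> q \<le> p}"
  have po: "partial_order_on S (relation_of (\<ge>) S)"
    by (auto simp: partial_order_on_def preorder_on_def refl_on_def trans_def antisym_def relation_of_def)
  have ch: "\<exists>u\<in>S. \<forall>a\<in>C. u \<le> a" if C: "C \<in> Chains (relation_of (\<ge>) S)" for C
  proof (cases "C = {}")
    case True
    then show ?thesis using p by (auto simp: S_def)
  next
    case False
    have CS: "C \<subseteq> S" and tot: "\<And>f g. f \<in> C \<Longrightarrow> g \<in> C \<Longrightarrow> f \<le> g \<or> g \<le> f"
      using C by (auto simp: Chains_def relation_of_def)
    define u where "u x = (INF q\<in>C. q x)" for x
    have bb: "bdd_below ((\<lambda>q. q x) ` C)" for x
    proof (rule bdd_belowI2)
      fix q assume "q \<in> C"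
      then have q: "sublinear q" "q \<le> p" using CS by (auto simp: S_def)
      have "- p (-x) \<le> - q (-x)" using q(2) by (simp add: le_fun_def)
      then show "- p (-x) \<le> q x" using sublinear_minus[OF q(1), of x] by linarith
    qed
    have le: "u x \<le> q x" if "q \<in> C" for q x
      unfolding u_def by (rule cINF_lower[OF bb that])
    have ge: "m \<le> u x" if "\<And>q. q \<in> C \<Longrightarrow> m \<le> q x" for m x
      unfolding u_def by (rule cINF_greatest[OF False that])
    have "u (x + y) \<le> u x + u y" for x y
    proof -
      have "u (x + y) - f x \<le> g y" if f: "f \<in> C" and g: "g \<in> C" for f g
      proof -
        \<comment> \<open>The chain supplies one member below both \<open>f\<close> and
          \<open>g\<close>, which lets two separate infima be bounded together.\<close>
        obtain k where k: "k \<in> C" "k \<le> f" "k \<le> g" using tot[OF f g] f g by blast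
        have "u (x + y) \<le> k (x + y)" by (rule le[OF k(1)])
        also have "\<dots> \<le> k x + k y" using k(1) CS by (auto simp: S_def sublinear_def)
        also have "\<dots> \<le> f x + g y" using k(2,3) by (simp add: le_fun_def add_mono)
        finally show ?thesis by simp
      qed
      then have "u (x + y) - f x \<le> u y" if "f \<in> C" for f using ge that by blast
      then have "u (x + y) - u y \<le> f x" if "f \<in> C" for f using that by (smt (verit))
      then have "u (x + y) - u y \<le> u x" using ge by blast
      then show ?thesis by simp
    qed
    moreover have "u (t *\<^sub>R x) = t * u x" if t: "0 < t" for t x
    proof (rule antisym)
      have "u (t *\<^sub>R x) / t \<le> u x"
      proof (rule ge)
        fix q assume q: "q \<in> C"
        have "u (t *\<^sub>R x) \<le> t * q x"
          using le[OF q, of "t *\<^sub>R x"] q CS t by (auto simp: S_def sublinear_def)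
        then show "u (t *\<^sub>R x) / t \<le> q x" using t by (simp add: field_simps)
      qed
      then show "u (t *\<^sub>R x) \<le> t * u x" using t by (simp add: field_simps)
      show "t * u x \<le> u (t *\<^sub>R x)"
      proof (rule ge)
        fix q assume q: "q \<in> C"
        have "q (t *\<^sub>R x) = t * q x" using q CS t by (auto simp: S_def sublinear_def)
        then show "t * u x \<le> q (t *\<^sub>R x)" using le[OF q, of x] t by simp
      qed
    qed
    ultimately have "sublinear u" by (simp add: sublinear_def)
    moreover have "u \<le> p"
    proof -
      obtain q where "q \<in> C" using False by blast
      then have "u \<le> q" "q \<le> p" using le CS by (auto simp: le_fun_def S_def)
      then show ?thesis by (rule order_trans)
    qed
    ultimately show ?thesis using le by (intro bexI[of _ u]) (auto simp: S_def le_fun_def)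
  qed
  obtain m where "m \<in> S" "\<And>a. a \<in> S \<Longrightarrow> a \<le> m \<Longrightarrow> a = m"
    using predicate_Zorn[OF po] ch by blast
  then show ?thesis using that[of m] order_trans[of _ m p] by (auto simp: S_def)
qed

text \<open>A minimal sublinear functional is already linear, so no extension from subspaces is
  involved.\<close>

theorem hahn_banach_sublinear:
  fixes p :: "'a::real_vector \<Rightarrow> real"
  assumes "sublinear p"
  obtains L where "linear L" "\<And>x. L x \<le> p x"
proof -
  obtain q where q: "sublinear q" "q \<le> p" and min: "\<And>g. sublinear g \<Longrightarrow> g \<le> q \<Longrightarrow> g = q"
    using minimal_sublinear_exists[OF assms] by blast
  have qadd: "q (x + y) \<le> q x + q y" and qscale: "0 < t \<Longrightarrow> q (t *\<^sub>R x) = t * q x" for x y t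
    using q(1) by (auto simp: sublinear_def)
  have q0: "q 0 = 0" by (rule sublinear_zero[OF q(1)])
  have qscale0: "q (t *\<^sub>R x) = t * q x" if "0 \<le> t" for t x
    using qscale[of t x] q0 that by (cases "t = 0") auto
  have add: "q (x + a) = q x + q a" for x a
  proof -
    \<comment> \<open>The competitor to \<open>q\<close>: it is sublinear and lies below
      \<open>q\<close> (take \<open>t = 0\<close>), so minimality gives \<open>g = q\<close>; then
      \<open>t = 1\<close> is the missing half of additivity.\<close>
    define g where "g x = (INF t\<in>{0..}. q (x + t *\<^sub>R a) - t * q a)" for x
    have bb: "bdd_below ((\<lambda>t. q (x + t *\<^sub>R a) - t * q a) ` {0..})" for x
    proof (rule bdd_belowI2)
      fix t :: real assume "t \<in> {0..}"
      then show "- q (- x) \<le> q (x + t *\<^sub>R a) - t * q a"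
        using qadd[of "x + t *\<^sub>R a" "- x"] qscale0[of t a] by simp
    qed
    have le: "g x \<le> q (x + t *\<^sub>R a) - t * q a" if "0 \<le> t" for t x
      unfolding g_def by (rule cINF_lower[OF bb]) (use that in auto)
    have ge: "m \<le> g x" if "\<And>t. 0 \<le> t \<Longrightarrow> m \<le> q (x + t *\<^sub>R a) - t * q a" for m x
      unfolding g_def by (rule cINF_greatest) (use that in auto)
    have "g (x + y) \<le> g x + g y" for x y
    proof -
      have "g (x + y) - (q (x + s *\<^sub>R a) - s * q a) \<le> q (y + t *\<^sub>R a) - t * q a"
        if "0 \<le> s" "0 \<le> t" for s t
      proof -
        have "g (x + y) \<le> q ((x + y) + (s + t) *\<^sub>R a) - (s + t) * q a"
          using that by (intro le) simp
        also have "(x + y) + (s + t) *\<^sub>R a = (x + s *\<^sub>R a) + (y + t *\<^sub>R a)"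
          by (simp add: algebra_simps)
        finally show ?thesis using qadd[of "x + s *\<^sub>R a" "y + t *\<^sub>R a"]
          by (simp add: algebra_simps)
      qed
      then have "g (x + y) - (q (x + s *\<^sub>R a) - s * q a) \<le> g y" if "0 \<le> s" for s
        using ge that by blast
      then have "g (x + y) - g y \<le> q (x + s *\<^sub>R a) - s * q a" if "0 \<le> s" for s
        using that by (smt (verit))
      then have "g (x + y) - g y \<le> g x" by (rule ge)
      then show ?thesis by simp
    qed
    moreover have scale1: "c * g x \<le> g (c *\<^sub>R x)" if c: "0 < c" for c x
    proof (rule ge)
      fix t :: real assume t: "0 \<le> t"
      have "c * g x \<le> c * (q (x + (t / c) *\<^sub>R a) - t / c * q a)"
        using c t by (intro mult_left_mono le) auto
      also have "\<dots> = q (c *\<^sub>R x + t *\<^sub>R a) - t * q a"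
        using c qscale[OF c, of "x + (t / c) *\<^sub>R a"] by (simp add: algebra_simps)
      finally show "c * g x \<le> q (c *\<^sub>R x + t *\<^sub>R a) - t * q a" .
    qed
    moreover have "g (c *\<^sub>R x) = c * g x" if c: "0 < c" for c x
    proof (rule antisym)
      show "g (c *\<^sub>R x) \<le> c * g x"
        using scale1[of "1 / c" "c *\<^sub>R x"] c by (simp add: field_simps)
    qed (rule scale1[OF c])
    ultimately have "sublinear g" by (simp add: sublinear_def)
    moreover have "g \<le> q" using le[of 0] by (simp add: le_fun_def)
    ultimately have "g = q" by (rule min)
    then have "q x \<le> q (x + a) - q a" using le[of 1 x] by simp
    then show ?thesis using qadd[of x a] by simp
  qed
  have neg: "q (- x) = - q x" for x using add[of x "- x"] q0 by simp
  have "linear q"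
  proof (rule linearI)
    fix c x show "q (c *\<^sub>R x) = c *\<^sub>R q x"
      using qscale0[of c x] qscale0[of "- c" x] neg[of "c *\<^sub>R x"] by (cases "0 \<le> c") auto
  qed (rule add)
  then show ?thesis using that[of q] q(2) by (simp add: le_fun_def)
qed

lemma linear_bounded_above_imp_bounded_linear:
  fixes f :: "'a::real_normed_vector \<Rightarrow> real"
  assumes f: "linear f" and d: "0 < d" and bd: "\<And>v. norm v < d \<Longrightarrow> f v \<le> K"
  shows "bounded_linear f"
proof -
  have K: "0 \<le> K" using bd[of 0] d linear_0[OF f] by simp
  have "f v \<le> norm v * (2 * K / d)" for v
  proof (cases "v = 0")
    case False
    define t where "t = d / (2 * norm v)"
    have t: "0 < t" using d False by (simp add: t_def)
    have "t * f v = f (t *\<^sub>R v)" by (simp add: linear_cmul[OF f])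
    also have "\<dots> \<le> K" using d False by (intro bd) (simp add: t_def)
    finally show ?thesis using t d False by (simp add: t_def field_simps)
  qed (simp add: linear_0[OF f])
  from this[of "- v" for v] this have "norm (f v) \<le> norm v * (2 * K / d)" for v
    by (simp add: linear_neg[OF f] abs_le_iff)
  then show ?thesis
    by (intro bounded_linear.intro bounded_linear_axioms.intro f) blast
qed

text \<open>\<open>D\<close> plays the hypograph of a concave function below \<open>P\<close>.
  Continuity of \<open>P\<close> at one point bounds the separating functional from above near 0,
  which makes it continuous.\<close>

theorem sandwich_theorem:
  fixes P :: "'e::real_normed_vector \<Rightarrow> real"
  assumes P: "convex_on UNIV P" "isCont P 0"
    and D: "convex D" "D \<noteq> {}" and below: "\<And>d r. (d, r) \<in> D \<Longrightarrow> r \<le> P d"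
  obtains L :: "'e \<Rightarrow>\<^sub>L real" and \<alpha>
    where "\<And>d r. (d, r) \<in> D \<Longrightarrow> r \<le> L d + \<alpha>" and "\<And>e. L e + \<alpha> \<le> P e"
proof -
  \<comment> \<open>Perspectives of \<open>v \<mapsto> P (d + v) - r\<close>. Their infimum
    \<open>q\<close> over \<open>D\<close> and \<open>t\<close> is sublinear, and a linear minorant
    of \<open>q\<close> separates.\<close>
  define Q where "Q v = {t * (P (d + v /\<^sub>R t) - r) |t d r. 0 < t \<and> (d, r) \<in> D}" for v
  define q where "q v = Inf (Q v)" for v
  have QI: "t * (P (d + v /\<^sub>R t) - r) \<in> Q v" if "0 < t" "(d, r) \<in> D" for t v d r
    unfolding Q_def mem_Collect_eq by (rule exI[of _ t], rule exI[of _ d], rule exI[of _ r]) (simp add: that)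
  have QE: thesis
    if "x \<in> Q v" "\<And>t d r. x = t * (P (d + v /\<^sub>R t) - r) \<Longrightarrow> 0 < t \<Longrightarrow> (d, r) \<in> D \<Longrightarrow> thesis" for x v thesis
    using that(1) unfolding Q_def mem_Collect_eq by (elim exE conjE) (rule that(2))
  have comb: "\<exists>d r. (d, r) \<in> D \<and> (t + s) * (P (d + (v + w) /\<^sub>R (t + s)) - r)
      \<le> t * (P (d1 + v /\<^sub>R t) - r1) + s * (P (d2 + w /\<^sub>R s) - r2)"
    if ts: "0 < t" "0 < s" and d: "(d1, r1) \<in> D" "(d2, r2) \<in> D" for t s v w d1 d2 r1 r2
  proof -
    define a where "a = t / (t + s)"
    define b where "b = s / (t + s)"
    have ab: "0 \<le> a" "0 \<le> b" "a + b = 1" using ts by (auto simp: a_def b_def simp flip: add_divide_distrib)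
    have at: "(t + s) * a = t" "(t + s) * b = s" using ts by (auto simp: a_def b_def)
    have inD: "(a *\<^sub>R d1 + b *\<^sub>R d2, a * r1 + b * r2) \<in> D"
      using convexD[OF D(1) d ab] by simp
    have "a *\<^sub>R d1 + b *\<^sub>R d2 + (v + w) /\<^sub>R (t + s) = a *\<^sub>R (d1 + v /\<^sub>R t) + b *\<^sub>R (d2 + w /\<^sub>R s)"
      using ts by (simp add: a_def b_def algebra_simps inverse_eq_divide)
    then have "P (a *\<^sub>R d1 + b *\<^sub>R d2 + (v + w) /\<^sub>R (t + s))
        \<le> a * P (d1 + v /\<^sub>R t) + b * P (d2 + w /\<^sub>R s)"
      using convex_onD[OF P(1), of b "d1 + v /\<^sub>R t" "d2 + w /\<^sub>R s"] ab
      by (metis UNIV_I add_diff_cancel_right' diff_ge_0_iff_ge)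
    then have "(t + s) * (P (a *\<^sub>R d1 + b *\<^sub>R d2 + (v + w) /\<^sub>R (t + s)) - (a * r1 + b * r2))
        \<le> (t + s) * (a * P (d1 + v /\<^sub>R t) + b * P (d2 + w /\<^sub>R s) - (a * r1 + b * r2))"
      using ts by (intro mult_left_mono) auto
    also have "\<dots> = ((t + s) * a) * (P (d1 + v /\<^sub>R t) - r1) + ((t + s) * b) * (P (d2 + w /\<^sub>R s) - r2)"
      by (simp add: algebra_simps)
    finally show ?thesis using inD unfolding at by blast
  qed
  obtain d0 r0 where d0: "(d0, r0) \<in> D" using D(2) by auto
  have Qne: "Q v \<noteq> {}" for v
    using QI[OF zero_less_one d0] by blast
  \<comment> \<open>Combining values at \<open>v\<close> and \<open>- v\<close> gives one at 0,
    where \<open>below\<close> applies; this keeps \<open>q\<close> above minus infinity.\<close>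
  have opp: "0 \<le> x + y" if xQ: "x \<in> Q v" and yQ: "y \<in> Q (- v)" for x y v
  proof -
    obtain t d1 r1 where x: "x = t * (P (d1 + v /\<^sub>R t) - r1)" "0 < t" "(d1, r1) \<in> D"
      by (rule QE[OF xQ])
    obtain s d2 r2 where y: "y = s * (P (d2 + (- v) /\<^sub>R s) - r2)" "0 < s" "(d2, r2) \<in> D"
      by (rule QE[OF yQ])
    obtain d r where d: "(d, r) \<in> D" "(t + s) * (P (d + (v + - v) /\<^sub>R (t + s)) - r) \<le> x + y"
      using comb[OF x(2) y(2) x(3) y(3), of v "- v"] x(1) y(1) by blast
    have "0 \<le> (t + s) * (P d - r)" using below[OF d(1)] x(2) y(2) by simp
    then show ?thesis using d(2) by simp
  qed
  have bb: "bdd_below (Q v)" for v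
  proof -
    obtain y where "y \<in> Q (- v)" using Qne by blast
    then show ?thesis using opp[of _ v y] by (intro bdd_belowI[of _ "- y"]) force
  qed
  have le: "q v \<le> x" if "x \<in> Q v" for x v
    unfolding q_def by (rule cInf_lower[OF that bb])
  have ge: "m \<le> q v" if "\<And>x. x \<in> Q v \<Longrightarrow> m \<le> x" for m v
    unfolding q_def by (rule cInf_greatest[OF Qne that])
  have "q (v + w) \<le> q v + q w" for v w
  proof -
    have "q (v + w) - x \<le> y" if xQ: "x \<in> Q v" and yQ: "y \<in> Q w" for x y
    proof -
      obtain t d1 r1 where x: "x = t * (P (d1 + v /\<^sub>R t) - r1)" "0 < t" "(d1, r1) \<in> D"
        by (rule QE[OF xQ])
      obtain s d2 r2 where y: "y = s * (P (d2 + w /\<^sub>R s) - r2)" "0 < s" "(d2, r2) \<in> D"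
        by (rule QE[OF yQ])
      obtain d r where d: "(d, r) \<in> D" "(t + s) * (P (d + (v + w) /\<^sub>R (t + s)) - r) \<le> x + y"
        using comb[OF x(2) y(2) x(3) y(3), of v w] x(1) y(1) by blast
      have "(t + s) * (P (d + (v + w) /\<^sub>R (t + s)) - r) \<in> Q (v + w)"
        by (rule QI[OF add_pos_pos[OF x(2) y(2)] d(1)])
      then show ?thesis using le d(2) by fastforce
    qed
    then have "q (v + w) - x \<le> q w" if "x \<in> Q v" for x using ge that by blast
    then have "q (v + w) - q w \<le> x" if "x \<in> Q v" for x using that by (smt (verit))
    then have "q (v + w) - q w \<le> q v" by (rule ge)
    then show ?thesis by simp
  qed
  moreover have scale: "c * q v \<le> q (c *\<^sub>R v)" if c: "0 < c" for c v
  proof (rule ge)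
    fix x assume xQ: "x \<in> Q (c *\<^sub>R v)"
    obtain t d r where x: "x = t * (P (d + (c *\<^sub>R v) /\<^sub>R t) - r)" "0 < t" "(d, r) \<in> D"
      by (rule QE[OF xQ])
    have "(t / c) * (P (d + v /\<^sub>R (t / c)) - r) \<in> Q v"
      by (rule QI) (use x c in auto)
    from le[OF this] have "c * q v \<le> c * ((t / c) * (P (d + v /\<^sub>R (t / c)) - r))"
      using c by (intro mult_left_mono) auto
    also have "\<dots> = x" using x c by (simp add: divide_simps)
    finally show "c * q v \<le> x" .
  qed
  moreover have "q (c *\<^sub>R v) = c * q v" if c: "0 < c" for c v
  proof (rule antisym)
    show "q (c *\<^sub>R v) \<le> c * q v" using scale[of "1 / c" "c *\<^sub>R v"] c by (simp add: field_simps)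
  qed (rule scale[OF c])
  ultimately have "sublinear q" by (simp add: sublinear_def)
  then obtain L where L: "linear L" "\<And>v. L v \<le> q v" using hahn_banach_sublinear by blast
  have sep: "r - L d \<le> P e - L e" if "(d, r) \<in> D" for d r e
  proof -
    have "1 * (P (d + (e - d) /\<^sub>R 1) - r) \<in> Q (e - d)"
      by (rule QI[OF zero_less_one that])
    then have "P e - r \<in> Q (e - d)" by simp
    then show ?thesis using le[of "P e - r" "e - d"] L(2)[of "e - d"] linear_diff[OF L(1), of e d] by linarith
  qed
  \<comment> \<open>Any number between the supremum of \<open>r - L d\<close> and this infimum would
    serve.\<close>
  define \<alpha> where "\<alpha> = (INF e. P e - L e)"
  have bb2: "bdd_below (range (\<lambda>e. P e - L e))"
    using sep[OF d0] by (intro bdd_belowI2)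
  have \<alpha>1: "\<alpha> \<le> P e - L e" for e unfolding \<alpha>_def by (rule cINF_lower[OF bb2]) simp
  have \<alpha>2: "r - L d \<le> \<alpha>" if "(d, r) \<in> D" for d r
    unfolding \<alpha>_def by (rule cINF_greatest) (use sep that in auto)
  obtain \<delta> where \<delta>: "0 < \<delta>" "\<And>e. dist e 0 < \<delta> \<Longrightarrow> dist (P e) (P 0) < 1"
    using P(2) unfolding continuous_at_eps_delta by (metis zero_less_one)
  have "L v \<le> P 0 + 1 - \<alpha>" if "norm v < \<delta>" for v
    using \<delta>(2)[of v] that \<alpha>1[of v] by (simp add: dist_real_def)
  then have "bounded_linear L" by (rule linear_bounded_above_imp_bounded_linear[OF L(1) \<delta>(1)])
  then have "blinfun_apply (Blinfun L) = L" by (rule bounded_linear_Blinfun_apply)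
  then show ?thesis using that[of "Blinfun L" \<alpha>] \<alpha>1 \<alpha>2 by (simp add: algebra_simps)
qed

section \<open>Squared norms, their conjugates and Young's inequality\<close>

lemma convex_on_norm_power2:
  assumes f: "linear f"
  shows "convex_on UNIV (\<lambda>x. (norm (f x - a))\<^sup>2)"
proof (rule convex_onI)
  fix t :: real and x y assume t: "0 < t" "t < 1"
  have "f ((1 - t) *\<^sub>R x + t *\<^sub>R y) - a = (1 - t) *\<^sub>R (f x - a) + t *\<^sub>R (f y - a)"
    by (simp add: linear_add[OF f] linear_diff[OF f] linear_cmul[OF f] algebra_simps)
  then have "norm (f ((1 - t) *\<^sub>R x + t *\<^sub>R y) - a) \<le> (1 - t) * norm (f x - a) + t * norm (f y - a)"
    using t by (smt (verit) norm_triangle_ineq norm_scaleR)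
  then have "(norm (f ((1 - t) *\<^sub>R x + t *\<^sub>R y) - a))\<^sup>2 \<le> ((1 - t) * norm (f x - a) + t * norm (f y - a))\<^sup>2"
    by (intro power_mono) auto
  also have "\<dots> = (1 - t) * (norm (f x - a))\<^sup>2 + t * (norm (f y - a))\<^sup>2
      - t * (1 - t) * (norm (f x - a) - norm (f y - a))\<^sup>2"
    by (simp add: power2_eq_square algebra_simps)
  also have "\<dots> \<le> (1 - t) * (norm (f x - a))\<^sup>2 + t * (norm (f y - a))\<^sup>2"
    using t by simp
  finally show "(norm (f ((1 - t) *\<^sub>R x + t *\<^sub>R y) - a))\<^sup>2 \<le> (1 - t) * (norm (f x - a))\<^sup>2 + t * (norm (f y - a))\<^sup>2" .
qed simp

text \<open>One half of the conjugacy between c/2 times the squared norm and 1/(2c) times the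
  squared dual norm; \<open>young_blinfun'\<close> is the other half. An arbitrary lower bound
  \<open>a\<close> stands in for the infimum.\<close>

lemma norm_power2_conjugate:
  fixes L :: "'a::real_normed_vector \<Rightarrow>\<^sub>L real"
  assumes c: "0 < c" and le: "\<And>v. a \<le> c * (norm v)\<^sup>2 / 2 - L v"
  shows "a \<le> - ((norm L)\<^sup>2 / (2 * c))"
proof -
  have a: "a \<le> 0" using le[of 0] by simp
  have "norm (L v) \<le> sqrt (- 2 * c * a) * norm v" for v
  proof (cases "v = 0")
    case False
    \<comment> \<open>The minimizer of the quadratic along the line through
      \<open>v\<close>.\<close>
    define t where "t = L v / (c * (norm v)\<^sup>2)"
    have "a \<le> c * (norm (t *\<^sub>R v))\<^sup>2 / 2 - L (t *\<^sub>R v)" by (rule le)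
    also have "\<dots> = t * (t * (c * (norm v)\<^sup>2)) / 2 - t * L v"
      by (simp add: blinfun.scaleR_right power_mult_distrib power2_eq_square)
    also have "\<dots> = - ((L v)\<^sup>2 / (2 * c * (norm v)\<^sup>2))"
      using c False by (simp add: t_def power2_eq_square)
    finally have "(L v)\<^sup>2 \<le> (- 2 * c * a) * (norm v)\<^sup>2"
      using c False by (simp add: field_simps)
    then have "sqrt ((L v)\<^sup>2) \<le> sqrt ((- 2 * c * a) * (norm v)\<^sup>2)" by (rule real_sqrt_le_mono)
    then show ?thesis unfolding real_sqrt_mult by simp
  qed simp
  then have "norm L \<le> sqrt (- 2 * c * a)"
    using a c by (intro norm_blinfun_bound) (auto simp: mult_nonneg_nonpos)
  then have "(norm L)\<^sup>2 \<le> (sqrt (- 2 * c * a))\<^sup>2" by (intro power_mono) auto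
  then have "(norm L)\<^sup>2 \<le> - 2 * c * a" using a c by (simp add: mult_nonneg_nonpos)
  then show ?thesis using c by (simp add: field_simps)
qed

lemma young_blinfun:
  fixes L :: "'a::real_normed_vector \<Rightarrow>\<^sub>L real"
  assumes "0 < c"
  shows "L v \<le> c * (norm L)\<^sup>2 / 2 + (norm v)\<^sup>2 / (2 * c)"
proof -
  have "L v \<le> norm L * norm v" using norm_blinfun[of L v] by simp
  also have "\<dots> \<le> c * (norm L)\<^sup>2 / 2 + (norm v)\<^sup>2 / (2 * c)"
  proof -
    have "0 \<le> (c * norm L - norm v)\<^sup>2" by simp
    then show ?thesis using assms by (simp add: power2_eq_square field_simps)
  qed
  finally show ?thesis .
qed

lemma young_blinfun':
  fixes L :: "'a::real_normed_vector \<Rightarrow>\<^sub>L real"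
  assumes "0 < c"
  shows "L v \<le> (norm L)\<^sup>2 / (2 * c) + c * (norm v)\<^sup>2 / 2"
  using young_blinfun[of "1 / c" L v] assms by (simp add: mult.commute)

lemma blinfun_prod_split:
  fixes L :: "('a::real_normed_vector \<times> 'b::real_normed_vector) \<Rightarrow>\<^sub>L real"
  obtains L1 :: "'a \<Rightarrow>\<^sub>L real" and L2 :: "'b \<Rightarrow>\<^sub>L real"
  where "\<And>a b. L (a, b) = L1 a + L2 b"
proof -
  have 1: "bounded_linear (\<lambda>a::'a. L (a, 0))" and 2: "bounded_linear (\<lambda>b::'b. L (0, b))"
    by (auto intro!: bounded_linear_intros)
  have split: "L (a, b) = L (a, 0) + L (0, b)" for a b
    using blinfun.add_right[of L "(a, 0)" "(0, b)"] by simp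
  show ?thesis
  proof (rule that)
    show "L (a, b) = Blinfun (\<lambda>a. L (a, 0)) a + Blinfun (\<lambda>b. L (0, b)) b" for a b
      unfolding bounded_linear_Blinfun_apply[OF 1] bounded_linear_Blinfun_apply[OF 2] by (rule split)
  qed
qed

lemma canon_apply [simp]:
  fixes x :: "'a::real_normed_vector"
  shows "blinfun_apply (canon x) f = blinfun_apply f x"
proof -
  have "bounded_linear (\<lambda>f::'a dual. blinfun_apply f x)" by (rule blinfun.bounded_linear_left)
  from bounded_linear_Blinfun_apply[OF this] show ?thesis by (simp add: canon_def)
qed

subsection \<open>The dual description of the composed regularization\<close>

text \<open>Used after separation: a variable ranging over a whole space can be scaled freely, which
  turns an inequality into an identity such as \<open>y' = x' o\<^sub>L A\<close>.\<close>

lemma scaled_bounded_above_imp_zero: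
  fixes c :: real
  assumes "\<And>t. t * c \<le> K"
  shows "c = 0"
proof (rule ccontr)
  assume "c \<noteq> 0"
  then have "K + 1 \<le> K" using assms[of "(K + 1) / c"] by simp
  then show False by simp
qed

text \<open>The supremum of \<open>\<zeta> u' + x' u - r\<close> over these triples is the
  Fitzpatrick function at \<open>(\<zeta>, x')\<close>. Passing to their convex hull leaves it
  unchanged and supplies the convex set that the sandwich theorem asks for.\<close>

definition triples :: "('a::real_normed_vector \<times> 'a dual) set \<Rightarrow> ('a \<times> 'a dual \<times> real) set" where
  "triples T = (\<lambda>(u, u'). (u, u', blinfun_apply u' u)) ` T"

text \<open>The set \<open>yosida_epi A T l\<close> is the epigraph of a convex lower semicontinuous function on
  \<open>Y \<times> Y*\<close>.  Its value at \<open>(y, y')\<close> is, by duality, the minimum of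
  \<open>\<phi>(z, x') + \<parallel>z - A y\<parallel>\<^sup>2 / (2 l) + l \<parallel>x'\<parallel>\<^sup>2 / 2\<close> over \<open>z\<close> in \<open>X**\<close> and \<open>x'\<close> with \<open>A* x' = y'\<close>, where
  \<open>\<phi>\<close> is the Fitzpatrick function of \<open>T\<close> extended to \<open>X** \<times> X*\<close> (\<open>yosida_epiI\<close>, \<open>yosida_epiE\<close>).
  Taking the dual formula as the definition makes semicontinuity evident, and attainment of the
  minimum produces the exact point \<open>z\<close> in the bidual that the regularization asks for.\<close>

definition yosida_epi :: "('b::real_normed_vector \<Rightarrow>\<^sub>L 'a::real_normed_vector) \<Rightarrow> ('a \<times> 'a dual) set
    \<Rightarrow> real \<Rightarrow> (('b \<times> 'b dual) \<times> real) set" where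
  "yosida_epi A T l = {((y, y'), M). \<forall>(u, u', r) \<in> convex hull (triples T). \<forall>v.
     blinfun_apply u' (A y) + blinfun_apply y' v - r - l * (norm u')\<^sup>2 / 2 - (norm (u - A v))\<^sup>2 / (2 * l) \<le> M}"

text \<open>Type (NI) in the sense of Simons.\<close>

definition negative_infimum :: "('a::real_normed_vector \<times> 'a dual) set \<Rightarrow> bool" where
  "negative_infimum T \<longleftrightarrow>
     (\<forall>z x'. \<forall>\<epsilon>>0. \<exists>(u, u') \<in> T. blinfun_apply (z - canon u) (x' - u') < \<epsilon>)"

lemma hull_triples_le:
  assumes T: "\<And>u u'. (u, u') \<in> T \<Longrightarrow> blinfun_apply \<zeta> u' + blinfun_apply x' u - blinfun_apply u' u \<le> M"
    and "(u, u', r) \<in> convex hull (triples T)"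
  shows "blinfun_apply \<zeta> u' + blinfun_apply x' u - r \<le> M"
proof -
  let ?H = "{(u, u', r). blinfun_apply \<zeta> u' + blinfun_apply x' u - r \<le> M}"
  have "convex ?H"
  proof (rule convexI, clarsimp)
    fix u1 u1' r1 u2 u2' r2 and s t :: real
    assume st: "0 \<le> s" "0 \<le> t" "s + t = 1"
      and *: "\<zeta> u1' + x' u1 - r1 \<le> M" "\<zeta> u2' + x' u2 - r2 \<le> M"
    have "s * (\<zeta> u1' + x' u1 - r1) + t * (\<zeta> u2' + x' u2 - r2) \<le> s * M + t * M"
      using st * by (intro add_mono mult_left_mono) auto
    also have "\<dots> = M" using st by (simp flip: distrib_right)
    finally show "\<zeta> (s *\<^sub>R u1' + t *\<^sub>R u2') + x' (s *\<^sub>R u1 + t *\<^sub>R u2) - (s * r1 + t * r2) \<le> M"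
      by (simp add: blinfun.bilinear_simps algebra_simps)
  qed
  moreover have "triples T \<subseteq> ?H" using T by (auto simp: triples_def)
  ultimately show ?thesis using hull_minimal[of "triples T" ?H convex] assms(2) by auto
qed

text \<open>With the pairings replaced by \<open>r\<close> and \<open>s\<close>, the monotonicity
  inequality is affine in each of the two triples, so it passes to the hull one argument at a
  time.\<close>

lemma hull_triples_monotone:
  assumes T: "monotone_op T"
    and x: "(x, x', r) \<in> convex hull (triples T)" and u: "(u, u', s) \<in> convex hull (triples T)"
  shows "blinfun_apply u' x + blinfun_apply x' u - s \<le> r"
proof -
  have "canon x u' + x' u - s \<le> r"
  proof (rule hull_triples_le[OF _ u])
    fix v v' assume v: "(v, v') \<in> T"
    have "canon v x' + v' x - r \<le> v' v"
    proof (rule hull_triples_le[OF _ x])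
      fix w w' assume "(w, w') \<in> T"
      then have "0 \<le> (w' - v') (w - v)" using T v by (auto simp: monotone_op_def)
      then show "canon v w' + v' w - w' w \<le> v' v" by (simp add: blinfun.bilinear_simps)
    qed
    then show "canon x v' + x' v - v' v \<le> r" by simp
  qed
  then show ?thesis by simp
qed

lemma mem_yosida_epi:
  "((y, y'), M) \<in> yosida_epi A T l \<longleftrightarrow> (\<forall>u u' r v. (u, u', r) \<in> convex hull (triples T) \<longrightarrow>
     blinfun_apply u' (A y) + blinfun_apply y' v - r - l * (norm u')\<^sup>2 / 2 - (norm (u - A v))\<^sup>2 / (2 * l) \<le> M)"
  by (auto simp: yosida_epi_def)

lemma closed_yosida_epi: "closed (yosida_epi A T l)"
proof -
  have "yosida_epi A T l = (\<Inter>(u, u', r) \<in> convex hull (triples T). \<Inter>v.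
     {p. blinfun_apply u' (A (fst (fst p))) + blinfun_apply (snd (fst p)) v - r - l * (norm u')\<^sup>2 / 2 - (norm (u - A v))\<^sup>2 / (2 * l) \<le> snd p})"
    by (force simp: yosida_epi_def)
  also have "closed \<dots>"
    by (intro closed_INT ballI) (auto intro!: closed_INT closed_Collect_le continuous_intros)
  finally show ?thesis .
qed

lemma convex_yosida_epi: "convex (yosida_epi A T l)"
proof (rule convexI)
  fix p q and s t :: real
  assume p: "p \<in> yosida_epi A T l" and q: "q \<in> yosida_epi A T l" and st: "0 \<le> s" "0 \<le> t" "s + t = 1"
  obtain y1 y1' M1 y2 y2' M2 where pq: "p = ((y1, y1'), M1)" "q = ((y2, y2'), M2)"
    by (metis surj_pair)
  have "blinfun_apply u' (A (s *\<^sub>R y1 + t *\<^sub>R y2)) + (s *\<^sub>R y1' + t *\<^sub>R y2') v - r - c - d \<le> s * M1 + t * M2"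
    if "blinfun_apply u' (A y1) + y1' v - r - c - d \<le> M1" "blinfun_apply u' (A y2) + y2' v - r - c - d \<le> M2" for u' v r c d
  proof -
    have rcd: "r = s * r + t * r" "c = s * c + t * c" "d = s * d + t * d"
      using st by (simp_all flip: distrib_right)
    have "s * (u' (A y1) + y1' v - r - c - d) + t * (u' (A y2) + y2' v - r - c - d) \<le> s * M1 + t * M2"
      using st that by (intro add_mono mult_left_mono) auto
    then show ?thesis using rcd by (simp add: blinfun.bilinear_simps algebra_simps)
  qed
  then show "s *\<^sub>R p + t *\<^sub>R q \<in> yosida_epi A T l"
    using p q by (simp add: pq mem_yosida_epi)
qed

lemma yosida_epi_mono:
  assumes "(p, M) \<in> yosida_epi A T l" "M \<le> N"
  shows "(p, N) \<in> yosida_epi A T l"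
proof -
  obtain y y' where p: "p = (y, y')" by (cases p)
  show ?thesis using assms(1) unfolding p mem_yosida_epi
    by (intro allI impI order_trans[OF _ assms(2)]) blast
qed

text \<open>Weak duality: two Young inequalities with parameter \<open>l\<close>, one for
  \<open>x'\<close> against \<open>A v - u\<close>, one for the bidual gap against
  \<open>u'\<close>, absorb the penalties of the dual formula.\<close>

lemma yosida_epiI:
  assumes l: "0 < l" and T: "\<And>u u'. (u, u') \<in> T \<Longrightarrow> blinfun_apply \<zeta> u' + blinfun_apply x' u - blinfun_apply u' u \<le> M"
  shows "((y, x' o\<^sub>L A), M + (norm (\<zeta> - canon (A y)))\<^sup>2 / (2 * l) + l * (norm x')\<^sup>2 / 2) \<in> yosida_epi A T l"
proof -
  have "blinfun_apply u' (A y) + (x' o\<^sub>L A) v - r - l * (norm u')\<^sup>2 / 2 - (norm (u - A v))\<^sup>2 / (2 * l)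
      \<le> M + (norm (\<zeta> - canon (A y)))\<^sup>2 / (2 * l) + l * (norm x')\<^sup>2 / 2"
    if "(u, u', r) \<in> convex hull (triples T)" for u u' r v
  proof -
    have "\<zeta> u' + x' u - r \<le> M" by (rule hull_triples_le[OF T that])
    moreover have "x' (A v - u) \<le> l * (norm x')\<^sup>2 / 2 + (norm (u - A v))\<^sup>2 / (2 * l)"
      using young_blinfun[OF l, of x' "A v - u"] by (simp add: norm_minus_commute)
    moreover have "(canon (A y) - \<zeta>) u' \<le> (norm (\<zeta> - canon (A y)))\<^sup>2 / (2 * l) + l * (norm u')\<^sup>2 / 2"
      using young_blinfun'[OF l, of "canon (A y) - \<zeta>" u'] by (simp add: norm_minus_commute)
    ultimately show ?thesis by (simp add: blinfun.bilinear_simps)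
  qed
  then show ?thesis by (simp add: mem_yosida_epi)
qed

text \<open>Strong duality with attainment. The separating functional on
  \<open>X \<times> X*\<close> splits into \<open>a\<close> and \<open>z\<close>; since
  \<open>z\<close> acts on \<open>X*\<close>, the minimizer \<open>\<zeta>\<close> lives in the
  bidual.\<close>

lemma yosida_epiE:
  fixes A :: "'b::real_normed_vector \<Rightarrow>\<^sub>L 'a::real_normed_vector"
  assumes l: "0 < l" and T: "T \<noteq> {}" and W: "((y, y'), M) \<in> yosida_epi A T l"
  obtains \<zeta> x' where "y' = x' o\<^sub>L A"
    and "\<And>u u'. (u, u') \<in> T \<Longrightarrow> blinfun_apply \<zeta> u' + blinfun_apply x' u - blinfun_apply u' u
          \<le> M - (norm (\<zeta> - canon (A y)))\<^sup>2 / (2 * l) - l * (norm x')\<^sup>2 / 2"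
proof -
  define C where "C = convex hull (triples T)"
  have tC: "(u, u', u' u) \<in> C" if "(u, u') \<in> T" for u u'
    unfolding C_def by (rule hull_inc) (use that in \<open>force simp: triples_def\<close>)
  define P where "P p = (norm (fst p))\<^sup>2 / (2 * l) + l * (norm (snd p))\<^sup>2 / 2 + M" for p :: "'a \<times> 'a dual"
  define f where "f = (\<lambda>((u, u', r), v). ((u - A v, u'), blinfun_apply u' (A y) + blinfun_apply y' v - r))"
  define D where "D = f ` (C \<times> UNIV)"
  have "linear f"
    unfolding f_def by (rule linearI) (auto simp: blinfun.bilinear_simps algebra_simps)
  then have D: "convex D" unfolding D_def C_def
    by (intro convex_linear_image convex_Times) auto
  have Dne: "D \<noteq> {}" using T tC unfolding D_def by fastforce
  have "convex_on UNIV (\<lambda>p::'a \<times> 'a dual. (1 / (2 * l)) * (norm (fst p - 0))\<^sup>2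
      + (l / 2) * (norm (snd p - 0))\<^sup>2 + M)"
    using l by (intro convex_on_add convex_on_cmul convex_on_norm_power2 linear_fst linear_snd)
      (auto simp: convex_on_def simp flip: distrib_right)
  then have Pc: "convex_on UNIV P" by (simp add: P_def[abs_def])
  have Pcont: "isCont P 0" unfolding P_def[abs_def] using l by (intro continuous_intros) auto
  have inD: "((u - A v, u'), u' (A y) + y' v - r) \<in> D" if "(u, u', r) \<in> C" for u u' r v
    unfolding D_def by (rule image_eqI[of _ _ "((u, u', r), v)"]) (use that in \<open>auto simp: f_def\<close>)
  have below: "r \<le> P d" if dD: "(d, r) \<in> D" for d r
  proof -
    obtain u u' s v where *: "(u, u', s) \<in> C" "d = (u - A v, u')" "r = blinfun_apply u' (A y) + y' v - s"
      using dD by (auto simp: D_def f_def)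
    have "blinfun_apply u' (A y) + y' v - s - l * (norm u')\<^sup>2 / 2 - (norm (u - A v))\<^sup>2 / (2 * l) \<le> M"
      using W *(1) unfolding mem_yosida_epi C_def by blast
    then show ?thesis by (simp add: * P_def)
  qed
  obtain L \<alpha> where L: "\<And>d r. (d, r) \<in> D \<Longrightarrow> r \<le> blinfun_apply L d + \<alpha>" "\<And>e. blinfun_apply L e + \<alpha> \<le> P e"
    using sandwich_theorem[OF Pc Pcont D Dne below] by blast
  obtain a z where az: "\<And>u u'. blinfun_apply L (u, u') = blinfun_apply a u + blinfun_apply z u'"
    using blinfun_prod_split by blast
  have main: "u' (A y) + y' v - r \<le> a (u - A v) + z u' + \<alpha>" if "(u, u', r) \<in> C" for u u' r v
    using L(1)[OF inD[OF that]] by (simp add: az)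
  define x' where "x' = - a"
  define \<zeta> where "\<zeta> = canon (A y) - z"
  obtain u0 u0' where u0: "(u0, u0') \<in> T" using T by auto
  \<comment> \<open>\<open>v\<close> is unconstrained in \<open>main\<close>, so its total
    coefficient must vanish.\<close>
  have "y' v - x' (A v) = 0" for v
  proof (rule scaled_bounded_above_imp_zero)
    show "t * (y' v - x' (A v)) \<le> a u0 + z u0' + \<alpha> - u0' (A y) + blinfun_apply u0' u0" for t
      using main[OF tC[OF u0], of "t *\<^sub>R v"]
      by (simp add: blinfun.bilinear_simps x'_def algebra_simps)
  qed
  then have y': "y' = x' o\<^sub>L A" by (intro blinfun_eqI) simp
  have \<alpha>: "\<alpha> + l * (norm x')\<^sup>2 / 2 + (norm z)\<^sup>2 / (2 * l) \<le> M"
  proof -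
    \<comment> \<open>The variables \<open>u\<close> and \<open>u'\<close> separate, so the
      conjugate of \<open>P\<close> is computed one norm at a time.\<close>
    have sep: "\<alpha> - M \<le> ((norm u)\<^sup>2 / (2 * l) - a u) + (l * (norm u')\<^sup>2 / 2 - z u')" for u u'
      using L(2)[of "(u, u')"] by (simp add: az P_def)
    have "\<alpha> - M - (l * (norm u')\<^sup>2 / 2 - z u') \<le> - ((norm a)\<^sup>2 / (2 * (1 / l)))" for u'
      using sep[of _ u'] l by (intro norm_power2_conjugate) (auto simp: algebra_simps)
    then have "\<alpha> - M + (norm a)\<^sup>2 / (2 * (1 / l)) \<le> l * (norm u')\<^sup>2 / 2 - z u'" for u'
      by (smt (verit))
    then have "\<alpha> - M + (norm a)\<^sup>2 / (2 * (1 / l)) \<le> - ((norm z)\<^sup>2 / (2 * l))"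
      by (rule norm_power2_conjugate[OF l])
    then show ?thesis using l by (simp add: x'_def mult.commute)
  qed
  show ?thesis
  proof (rule that[OF y'])
    fix u u' assume "(u, u') \<in> T"
    from main[OF tC[OF this], of 0] \<alpha>
    show "blinfun_apply \<zeta> u' + blinfun_apply x' u - blinfun_apply u' u \<le> M - (norm (\<zeta> - canon (A y)))\<^sup>2 / (2 * l) - l * (norm x')\<^sup>2 / 2"
      by (simp add: \<zeta>_def x'_def blinfun.bilinear_simps)
  qed
qed

section \<open>Type (NI) and the lower bound by the pairing\<close>

text \<open>The form in which type (NI) is used: \<open>M\<close> is any bound on the Fitzpatrick
  function at \<open>(\<zeta>, x')\<close>, which therefore majorizes the pairing on the bidual
  too.\<close>

lemma negative_infimum_le:
  assumes "negative_infimum T" and le: "\<And>u u'. (u, u') \<in> T \<Longrightarrow> blinfun_apply \<zeta> u' + blinfun_apply x' u - blinfun_apply u' u \<le> M"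
  shows "blinfun_apply \<zeta> x' \<le> M"
proof (rule field_le_epsilon)
  fix e :: real assume "0 < e"
  then obtain u u' where u: "(u, u') \<in> T" "blinfun_apply (\<zeta> - canon u) (x' - u') < e"
    using assms(1) unfolding negative_infimum_def by blast
  then show "\<zeta> x' \<le> M + e" using le[OF u(1)] by (simp add: blinfun.bilinear_simps)
qed

lemma negative_infimum_nonempty:
  assumes "negative_infimum T" shows "T \<noteq> {}"
proof -
  have "\<exists>(u, u') \<in> T. blinfun_apply (0 - canon u) (0 - u') < 1"
    using assms zero_less_one unfolding negative_infimum_def by blast
  then show ?thesis by auto
qed

lemma yosida_epi_ge_pairing:
  assumes "0 < l" "negative_infimum T" "((y, y'), M) \<in> yosida_epi A T l"
  shows "blinfun_apply y' y \<le> M"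
proof -
  obtain \<zeta> x' where y': "y' = x' o\<^sub>L A" and le: "\<And>u u'. (u, u') \<in> T \<Longrightarrow> blinfun_apply \<zeta> u' + blinfun_apply x' u - blinfun_apply u' u
          \<le> M - (norm (\<zeta> - canon (A y)))\<^sup>2 / (2 * l) - l * (norm x')\<^sup>2 / 2"
    by (rule yosida_epiE[OF assms(1) negative_infimum_nonempty[OF assms(2)] assms(3)]) (rule that, assumption, blast)
  have "\<zeta> x' \<le> M - (norm (\<zeta> - canon (A y)))\<^sup>2 / (2 * l) - l * (norm x')\<^sup>2 / 2"
    by (rule negative_infimum_le[OF assms(2) le])
  moreover have "(canon (A y) - \<zeta>) x' \<le> (norm (\<zeta> - canon (A y)))\<^sup>2 / (2 * l) + l * (norm x')\<^sup>2 / 2"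
    using young_blinfun'[OF assms(1), of "canon (A y) - \<zeta>" x'] by (simp add: norm_minus_commute)
  ultimately show ?thesis by (simp add: y' blinfun.bilinear_simps)
qed

text \<open>The lower bound by the pairing is the sum of type (NI) at \<open>(\<zeta>, x')\<close>
  and a Young inequality. If the sum is an equality, so are both: the first gives membership in
  \<open>tilde_op T\<close>, the second the resolvent condition.\<close>

lemma yosida_epi_eq_pairing:
  assumes "0 < l" "negative_infimum T" "((y, y'), blinfun_apply y' y) \<in> yosida_epi A T l"
  obtains \<zeta> x' where "y' = x' o\<^sub>L A" "(\<zeta>, x') \<in> tilde_op T"
    "(norm (\<zeta> - canon (A y)))\<^sup>2 / (2 * l) + l * (norm x')\<^sup>2 / 2 \<le> - blinfun_apply (\<zeta> - canon (A y)) x'"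
proof -
  obtain \<zeta> x' where y': "y' = x' o\<^sub>L A" and le: "\<And>u u'. (u, u') \<in> T \<Longrightarrow> blinfun_apply \<zeta> u' + blinfun_apply x' u - blinfun_apply u' u
          \<le> y' y - (norm (\<zeta> - canon (A y)))\<^sup>2 / (2 * l) - l * (norm x')\<^sup>2 / 2"
    by (rule yosida_epiE[OF assms(1) negative_infimum_nonempty[OF assms(2)] assms(3)]) (rule that, assumption, blast)
  have 1: "\<zeta> x' \<le> y' y - (norm (\<zeta> - canon (A y)))\<^sup>2 / (2 * l) - l * (norm x')\<^sup>2 / 2"
    by (rule negative_infimum_le[OF assms(2) le])
  have 2: "(canon (A y) - \<zeta>) x' \<le> (norm (\<zeta> - canon (A y)))\<^sup>2 / (2 * l) + l * (norm x')\<^sup>2 / 2"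
    using young_blinfun'[OF assms(1), of "canon (A y) - \<zeta>" x'] by (simp add: norm_minus_commute)
  have "blinfun_apply \<zeta> u' + blinfun_apply x' u - blinfun_apply u' u \<le> \<zeta> x'" if "(u, u') \<in> T" for u u'
    using le[OF that] 2 by (simp add: y' blinfun.bilinear_simps)
  then have tilde: "(\<zeta>, x') \<in> tilde_op T"
    by (fastforce simp: tilde_op_def blinfun.bilinear_simps)
  show ?thesis
    by (rule that[OF y' tilde]) (use 1 in \<open>simp add: y' blinfun.bilinear_simps\<close>)
qed

section \<open>Quasidensity\<close>

text \<open>An exact minimizer exists only if \<open>L\<close> attains its norm, so near-minimizers
  must do.\<close>

lemma norm_power2_conjugate_approx:
  fixes L :: "'a::real_normed_vector \<Rightarrow>\<^sub>L real"
  assumes "0 < c" "0 < e"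
  obtains v where "c * (norm v)\<^sup>2 / 2 - L v \<le> - ((norm L)\<^sup>2 / (2 * c)) + e"
proof (rule ccontr)
  assume "\<not> thesis"
  then have "- ((norm L)\<^sup>2 / (2 * c)) + e \<le> c * (norm v)\<^sup>2 / 2 - L v" for v
    using that[of v] by linarith
  from norm_power2_conjugate[OF assms(1) this] assms(2) show False by simp
qed

lemma norm_canon_le: "norm (canon x) \<le> norm x"
proof (rule norm_blinfun_bound)
  show "norm (blinfun_apply (canon x) f) \<le> norm x * norm f" for f
    using norm_blinfun[of f x] by (simp add: mult.commute)
qed simp

lemma canon_diff: "canon x - canon y = canon (x - y)"
  by (rule blinfun_eqI) (simp add: blinfun.bilinear_simps)

text \<open>Monotonicity bounds the Fitzpatrick function at a hull point by \<open>r\<close>. This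
  supplies the explicit points on which quasidensity is tested.\<close>

lemma yosida_epi_hullI:
  assumes l: "0 < l" and T: "monotone_op T" and x: "(x, x', r) \<in> convex hull (triples T)"
  shows "((y, x' o\<^sub>L A), r + (norm (x - A y))\<^sup>2 / (2 * l) + l * (norm x')\<^sup>2 / 2) \<in> yosida_epi A T l"
proof (rule yosida_epi_mono)
  show "((y, x' o\<^sub>L A), r + (norm (canon x - canon (A y)))\<^sup>2 / (2 * l) + l * (norm x')\<^sup>2 / 2) \<in> yosida_epi A T l"
  proof (rule yosida_epiI[OF l])
    fix u u' assume "(u, u') \<in> T"
    then have "(u, u', blinfun_apply u' u) \<in> convex hull (triples T)"
      by (intro hull_inc) (force simp: triples_def)
    from hull_triples_monotone[OF T x this]
    show "blinfun_apply (canon x) u' + blinfun_apply x' u - blinfun_apply u' u \<le> r" by simp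
  qed
  show "r + (norm (canon x - canon (A y)))\<^sup>2 / (2 * l) + l * (norm x')\<^sup>2 / 2
      \<le> r + (norm (x - A y))\<^sup>2 / (2 * l) + l * (norm x')\<^sup>2 / 2"
    using l norm_canon_le[of "x - A y"]
    by (intro add_mono divide_right_mono power_mono) (auto simp: canon_diff)
qed

text \<open>Adding the three defects (of \<open>(x, x')\<close> being in \<open>T\<close>, of the resolvent inclusion, and of
  \<open>(y - y0, y' - y0')\<close> being in \<open>-J\<close>) cancels all bilinear terms, which leaves a jointly convex function;
  were its infimum positive, the sandwich theorem would separate it and contradict type (NI).\<close>

lemma yosida_epi_quasidense:
  fixes A :: "'b::real_normed_vector \<Rightarrow>\<^sub>L 'a::real_normed_vector"
  assumes l: "0 < l" and T: "monotone_op T" and NI: "negative_infimum T" and e: "0 < e"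
  shows "\<exists>y y' M. ((y, y'), M) \<in> yosida_epi A T l \<and>
    M - blinfun_apply y' y + (norm (y - y0))\<^sup>2 / 2 + (norm (y' - y0'))\<^sup>2 / 2
      + blinfun_apply (y' - y0') (y - y0) \<le> e"
proof (rule ccontr)
  assume contr: "\<not> ?thesis"
  define C where "C = convex hull (triples T)"
  have tC: "(u, u', blinfun_apply u' u) \<in> C" if "(u, u') \<in> T" for u u'
    unfolding C_def by (rule hull_inc) (use that in \<open>force simp: triples_def\<close>)
  define P where "P p = (1 / (2 * l)) * (norm (fst (fst p) - 0))\<^sup>2 + (l / 2) * (norm (snd (fst p) - 0))\<^sup>2
      + (1 / 2) * (norm (fst (snd p) - y0))\<^sup>2 + (1 / 2) * (norm (snd (snd p) - y0'))\<^sup>2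
      + (- blinfun_apply (snd (snd p)) y0 - blinfun_apply y0' (fst (snd p)) + (blinfun_apply y0' y0 - e))"
    for p :: "('a \<times> 'a dual) \<times> ('b \<times> 'b dual)"
  define f where "f = (\<lambda>((x :: 'a, x' :: 'a dual, r :: real), y). (((x - blinfun_apply A y, x'), (y, x' o\<^sub>L A)), - r))"
  define D where "D = f ` (C \<times> UNIV)"
  have comp: "(s + t) o\<^sub>L A = (s o\<^sub>L A) + (t o\<^sub>L A)" "(c *\<^sub>R s) o\<^sub>L A = c *\<^sub>R (s o\<^sub>L A)" for s t :: "'a dual" and c
    by (auto intro!: blinfun_eqI simp: blinfun.bilinear_simps)
  have "linear f"
    unfolding f_def by (rule linearI) (auto simp: blinfun.bilinear_simps algebra_simps comp)
  then have D: "convex D" unfolding D_def C_def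
    by (intro convex_linear_image convex_Times) auto
  have Dne: "D \<noteq> {}" using negative_infimum_nonempty[OF NI] tC unfolding D_def by fastforce
  have aff: "convex_on UNIV (\<lambda>p::('a \<times> 'a dual) \<times> ('b \<times> 'b dual).
      - blinfun_apply (snd (snd p)) y0 - blinfun_apply y0' (fst (snd p)) + (blinfun_apply y0' y0 - e))"
    by (rule convex_onI) (auto simp: blinfun.bilinear_simps algebra_simps)
  have lin: "linear (\<lambda>p::('a \<times> 'a dual) \<times> ('b \<times> 'b dual). fst (fst p))"
    "linear (\<lambda>p::('a \<times> 'a dual) \<times> ('b \<times> 'b dual). snd (fst p))"
    "linear (\<lambda>p::('a \<times> 'a dual) \<times> ('b \<times> 'b dual). fst (snd p))"
    "linear (\<lambda>p::('a \<times> 'a dual) \<times> ('b \<times> 'b dual). snd (snd p))"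
    by (auto intro!: linearI)
  have Pc: "convex_on UNIV P" unfolding P_def[abs_def]
    by (intro convex_on_add convex_on_cmul convex_on_norm_power2 lin aff) (use l in auto)
  have Pcont: "isCont P 0" unfolding P_def[abs_def] by (intro continuous_intros)
  have inD: "(((x - A y, x'), (y, x' o\<^sub>L A)), - r) \<in> D" if "(x, x', r) \<in> C" for x x' r y
    unfolding D_def by (rule image_eqI[of _ _ "((x, x', r), y)"]) (use that in \<open>auto simp: f_def\<close>)
  have below: "s \<le> P d" if dD: "(d, s) \<in> D" for d s
  proof -
    obtain x x' r y where *: "(x, x', r) \<in> C" "d = ((x - A y, x'), (y, x' o\<^sub>L A))" "s = - r"
      using dD by (auto simp: D_def f_def)
    have "((y, x' o\<^sub>L A), r + (norm (x - A y))\<^sup>2 / (2 * l) + l * (norm x')\<^sup>2 / 2) \<in> yosida_epi A T l"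
      by (rule yosida_epi_hullI[OF l T *(1)[unfolded C_def]])
    then have "e < r + (norm (x - A y))\<^sup>2 / (2 * l) + l * (norm x')\<^sup>2 / 2 - (x' o\<^sub>L A) y
        + (norm (y - y0))\<^sup>2 / 2 + (norm ((x' o\<^sub>L A) - y0'))\<^sup>2 / 2 + ((x' o\<^sub>L A) - y0') (y - y0)"
      using contr by (meson not_le)
    then show ?thesis by (simp add: * P_def blinfun.bilinear_simps)
  qed
  obtain L \<alpha> where L: "\<And>d r. (d, r) \<in> D \<Longrightarrow> r \<le> blinfun_apply L d + \<alpha>" "\<And>e. blinfun_apply L e + \<alpha> \<le> P e"
    using sandwich_theorem[OF Pc Pcont D Dne below] by blast
  obtain L1 L2 where L12: "\<And>p q. blinfun_apply L (p, q) = blinfun_apply L1 p + blinfun_apply L2 q"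
    using blinfun_prod_split by blast
  obtain a z where az: "\<And>x x'. blinfun_apply L1 (x, x') = blinfun_apply a x + blinfun_apply z x'"
    using blinfun_prod_split by blast
  obtain b \<eta> where b\<eta>: "\<And>y y'. blinfun_apply L2 (y, y') = blinfun_apply b y + blinfun_apply \<eta> y'"
    using blinfun_prod_split by blast
  have main: "- r \<le> a (x - A y) + z x' + b y + \<eta> (x' o\<^sub>L A) + \<alpha>" if "(x, x', r) \<in> C" for x x' r y
    using L(1)[OF inD[OF that, of y]] by (simp add: L12 az b\<eta>)
  obtain u0 u0' where u0: "(u0, u0') \<in> T" using negative_infimum_nonempty[OF NI] by auto
  have "a (A y) - b y = 0" for y
  proof (rule scaled_bounded_above_imp_zero)
    show "t * (a (A y) - b y) \<le> a u0 + z u0' + \<eta> (u0' o\<^sub>L A) + \<alpha> + blinfun_apply u0' u0" for t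
      using main[OF tC[OF u0], of "t *\<^sub>R y"] by (simp add: blinfun.bilinear_simps algebra_simps)
  qed
  then have b: "b = a o\<^sub>L A" by (intro blinfun_eqI) simp
  have bl: "bounded_linear (\<lambda>x'. \<eta> (x' o\<^sub>L A))" by (intro bounded_linear_intros)
  \<comment> \<open>\<open>Z\<close> is \<open>z + A** \<eta>\<close>. Type (NI) at
    \<open>(- Z, - a)\<close> bounds \<open>\<alpha>\<close> from below, against the upper bound
    from \<open>P\<close>.\<close>
  define Z where "Z = z + Blinfun (\<lambda>x'. \<eta> (x' o\<^sub>L A))"
  have Z: "Z x' = z x' + \<eta> (x' o\<^sub>L A)" for x'
    unfolding Z_def plus_blinfun.rep_eq bounded_linear_Blinfun_apply[OF bl] ..
  have "(- Z) (- a) \<le> \<alpha>"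
  proof (rule negative_infimum_le[OF NI])
    fix u u' assume "(u, u') \<in> T"
    from main[OF tC[OF this], of 0]
    show "blinfun_apply (- Z) u' + blinfun_apply (- a) u - blinfun_apply u' u \<le> \<alpha>"
      by (simp add: blinfun.bilinear_simps Z)
  qed
  then have lower: "z a + \<eta> b \<le> \<alpha>" by (simp add: blinfun.bilinear_simps Z b)
  \<comment> \<open>Four near-minimizers, one per squared norm in \<open>P\<close>, lose e/8 each:
    e/2 in all, less than the assumed gap \<open>e\<close>.\<close>
  have e8: "0 < e / 8" using e by simp
  obtain v where "(1 / l) * (norm v)\<^sup>2 / 2 - a v \<le> - ((norm a)\<^sup>2 / (2 * (1 / l))) + e / 8"
    using norm_power2_conjugate_approx[of "1 / l", OF _ e8] l by auto
  then have v: "(norm v)\<^sup>2 / (2 * l) - a v \<le> - (l * (norm a)\<^sup>2 / 2) + e / 8"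
    by (simp add: mult.commute)
  obtain x' where x': "l * (norm x')\<^sup>2 / 2 - z x' \<le> - ((norm z)\<^sup>2 / (2 * l)) + e / 8"
    using norm_power2_conjugate_approx[OF l e8] by blast
  obtain d where d: "1 * (norm d)\<^sup>2 / 2 - (y0' + b) d \<le> - ((norm (y0' + b))\<^sup>2 / (2 * 1)) + e / 8"
    using norm_power2_conjugate_approx[OF zero_less_one e8] by blast
  obtain d' where d': "1 * (norm d')\<^sup>2 / 2 - (canon y0 + \<eta>) d' \<le> - ((norm (canon y0 + \<eta>))\<^sup>2 / (2 * 1)) + e / 8"
    using norm_power2_conjugate_approx[OF zero_less_one e8] by blast
  have "a v + z x' + (b (y0 + d) + \<eta> (y0' + d')) + \<alpha>
      \<le> (norm v)\<^sup>2 / (2 * l) + l * (norm x')\<^sup>2 / 2 + (norm d)\<^sup>2 / 2 + (norm d')\<^sup>2 / 2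
        - (y0' + d') y0 - y0' (y0 + d) + (y0' y0 - e)"
    using L(2)[of "((v, x'), (y0 + d, y0' + d'))"] by (simp add: L12 az b\<eta> P_def)
  moreover have "(- z) a \<le> (norm z)\<^sup>2 / (2 * l) + l * (norm a)\<^sup>2 / 2"
    using young_blinfun'[OF l, of "- z" a] by simp
  moreover have "(- (canon y0 + \<eta>)) (y0' + b) \<le> 1 * (norm (canon y0 + \<eta>))\<^sup>2 / 2 + (norm (y0' + b))\<^sup>2 / (2 * 1)"
    using young_blinfun[OF zero_less_one, of "- (canon y0 + \<eta>)" "y0' + b"] by (simp only: norm_minus_cancel)
  ultimately show False using lower v x' d d' e by (simp add: blinfun.bilinear_simps)
qed

subsection \<open>The Broensted-Rockafellar property\<close>

abbreviation pairing :: "'b::real_normed_vector \<times> 'b dual \<Rightarrow> real" where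
  "pairing p \<equiv> blinfun_apply (snd p) (fst p)"

text \<open>The midpoint of \<open>p\<close> and \<open>q\<close> has a value above its pairing, and
  the pairing there differs from the average by a quarter of the mixed term. This controls the only
  term of the quasidensity estimate that has no sign.\<close>

lemma quasidense_step:
  fixes W :: "(('b::real_normed_vector \<times> 'b dual) \<times> real) set"
  assumes W: "convex W" and ge: "\<And>p M. (p, M) \<in> W \<Longrightarrow> pairing p \<le> M"
    and p: "(p, M) \<in> W" "M - pairing p \<le> e"
    and q: "(q, N) \<in> W" "N - pairing q + (norm (fst q - fst p))\<^sup>2 / 2 + (norm (snd q - snd p))\<^sup>2 / 2
      + blinfun_apply (snd q - snd p) (fst q - fst p) \<le> e / 4"
  shows "N - pairing q \<le> e / 4" "dist q p \<le> 4 * sqrt e"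
proof -
  define a where "a = fst q - fst p"
  define b where "b = snd q - snd p"
  have "(- b) a \<le> 1 * (norm (- b))\<^sup>2 / 2 + (norm a)\<^sup>2 / (2 * 1)"
    by (rule young_blinfun[OF zero_less_one])
  then show N: "N - pairing q \<le> e / 4"
    using q(2) by (simp add: blinfun.minus_left flip: a_def b_def)
  have e: "0 \<le> e" using ge[OF p(1)] p(2) by simp
  have "((1/2) *\<^sub>R p + (1/2) *\<^sub>R q, (1/2) * M + (1/2) * N) \<in> W"
    using convexD[OF W p(1) q(1), of "1/2" "1/2"] by simp
  from ge[OF this] have "- b a \<le> 2 * (M - pairing p) + 2 * (N - pairing q)"
    by (simp add: a_def b_def blinfun.bilinear_simps field_simps)
  \<comment> \<open>The estimates even give \<open>5 * e\<close>; 16 is a convenient square.\<close>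
  then have "(norm a)\<^sup>2 + (norm b)\<^sup>2 \<le> 16 * e"
    using q(2) N p(2) ge[OF q(1)] e by (simp flip: a_def b_def)
  then have "sqrt ((norm a)\<^sup>2 + (norm b)\<^sup>2) \<le> sqrt (16 * e)" by (rule real_sqrt_le_mono)
  then show "dist q p \<le> 4 * sqrt e"
    by (simp add: real_sqrt_mult dist_norm norm_prod_def a_def b_def)
qed

lemma quasidense_imp_bronsted_rockafellar:
  fixes W :: "(('b::banach \<times> 'b dual) \<times> real) set"
  assumes W: "closed W" "convex W" and ge: "\<And>p M. (p, M) \<in> W \<Longrightarrow> pairing p \<le> M"
    and qd: "\<And>p e. 0 < e \<Longrightarrow> \<exists>q N. (q, N) \<in> W \<and> N - pairing q + (norm (fst q - fst p))\<^sup>2 / 2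
      + (norm (snd q - snd p))\<^sup>2 / 2 + blinfun_apply (snd q - snd p) (fst q - fst p) \<le> e"
    and e: "0 < e" and p0: "(p0, M0) \<in> W" "M0 - pairing p0 \<le> e"
  obtains p where "(p, pairing p) \<in> W" "dist p p0 \<le> 8 * sqrt e"
proof -
  \<comment> \<open>The clause for \<open>n = 0\<close> pins the start, since dependent choice by
    itself only provides some initial element.\<close>
  define P where "P n x \<longleftrightarrow> x \<in> W \<and> snd x - pairing (fst x) \<le> e / 4 ^ n \<and> (n = 0 \<longrightarrow> x = (p0, M0))" for n x
  define Q where "Q n x y \<longleftrightarrow> dist (fst y) (fst x) \<le> 4 * sqrt e * (1 / 2) ^ n" for n :: nat and x y :: "('b \<times> 'b dual) \<times> real"
  have "\<exists>f. \<forall>n. P n (f n) \<and> Q n (f n) (f (Suc n))"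
  proof (rule dependent_nat_choice)
    show "\<exists>x. P 0 x" using p0 by (intro exI[of _ "(p0, M0)"]) (simp add: P_def)
    fix x n assume x: "P n x"
    have "0 < e / 4 ^ n / 4" using e by simp
    then obtain q N where q: "(q, N) \<in> W" "N - pairing q + (norm (fst q - fst (fst x)))\<^sup>2 / 2
      + (norm (snd q - snd (fst x)))\<^sup>2 / 2 + blinfun_apply (snd q - snd (fst x)) (fst q - fst (fst x)) \<le> e / 4 ^ n / 4"
      using qd by blast
    have xW: "(fst x, snd x) \<in> W" "snd x - pairing (fst x) \<le> e / 4 ^ n" using x by (auto simp: P_def)
    note step = quasidense_step[OF W(2) ge xW q]
    have "sqrt (e / 4 ^ n) = sqrt e * (1 / 2) ^ n"
      using real_sqrt_power[of 4 n] by (simp add: real_sqrt_divide power_divide)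
    then show "\<exists>y. P (Suc n) y \<and> Q n x y"
      using step q(1) by (intro exI[of _ "(q, N)"]) (simp add: P_def Q_def mult.commute)
  qed
  then obtain f where f: "\<And>n. P n (f n)" "\<And>n. Q n (f n) (f (Suc n))" by blast
  define d where "d n = fst (f (Suc n)) - fst (f n)" for n
  have dn: "norm (d n) \<le> 4 * sqrt e * (1 / 2) ^ n" for n
    using f(2)[of n] by (simp add: Q_def d_def dist_norm)
  have gs: "summable (\<lambda>n. 4 * sqrt e * (1 / 2) ^ n)" by (intro summable_mult summable_geometric) simp
  have ns: "summable (\<lambda>n. norm (d n))" by (rule summable_comparison_test'[OF gs]) (use dn in auto)
  have f0: "fst (f 0) = p0" using f(1)[of 0] by (simp add: P_def)
  have "(\<lambda>n. \<Sum>i<n. d i) \<longlonglongrightarrow> suminf d"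
    using summable_LIMSEQ[OF summable_norm_cancel[OF ns]] .
  moreover have "(\<Sum>i<n. d i) = fst (f n) - p0" for n
    unfolding d_def using sum_lessThan_telescope[of "\<lambda>n. fst (f n)" n] f0 by simp
  ultimately have "(\<lambda>n. fst (f n) - p0) \<longlonglongrightarrow> suminf d" by simp
  from tendsto_add[OF this tendsto_const[of p0]] have lim: "(\<lambda>n. fst (f n)) \<longlonglongrightarrow> suminf d + p0" by simp
  define p where "p = suminf d + p0"
  have "norm (suminf d) \<le> (\<Sum>n. norm (d n))" by (rule summable_norm[OF ns])
  also have "\<dots> \<le> (\<Sum>n. 4 * sqrt e * (1 / 2) ^ n)" by (rule suminf_le[OF dn ns gs])
  also have "\<dots> = 8 * sqrt e" by (simp add: suminf_mult suminf_geometric)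
  finally have dist: "dist p p0 \<le> 8 * sqrt e" by (simp add: p_def dist_norm)
  have pl: "(\<lambda>n. pairing (fst (f n))) \<longlonglongrightarrow> pairing p"
    unfolding p_def by (intro tendsto_intros lim)
  have "(\<lambda>n. snd (f n) - pairing (fst (f n))) \<longlonglongrightarrow> 0"
  proof (rule tendsto_sandwich[OF _ _ tendsto_const])
    show "(\<lambda>n. e * (1 / 4) ^ n) \<longlonglongrightarrow> 0"
      by (intro tendsto_mult_right_zero LIMSEQ_power_zero) simp
    show "\<forall>\<^sub>F n in sequentially. snd (f n) - pairing (fst (f n)) \<le> e * (1 / 4) ^ n"
      using f(1) by (auto simp: P_def power_divide)
    show "\<forall>\<^sub>F n in sequentially. 0 \<le> snd (f n) - pairing (fst (f n))"
      using f(1) ge by (auto simp: P_def intro!: always_eventually)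
  qed
  from tendsto_add[OF this pl] have "(\<lambda>n. snd (f n)) \<longlonglongrightarrow> pairing p" by simp
  with lim have flim: "(\<lambda>n. (fst (f n), snd (f n))) \<longlonglongrightarrow> (p, pairing p)"
    unfolding p_def by (rule tendsto_Pair)
  have "(fst (f n), snd (f n)) \<in> W" for n using f(1) by (simp add: P_def)
  then have "(p, pairing p) \<in> W" by (rule closed_sequentially[OF W(1) _ flim])
  then show ?thesis using dist by (rule that)
qed

lemma yosida_epi_bronsted_rockafellar:
  fixes A :: "'b::banach \<Rightarrow>\<^sub>L 'a::real_normed_vector"
  assumes l: "0 < l" and T: "monotone_op T" and NI: "negative_infimum T" and e: "0 < e"
    and p0: "(p0, M0) \<in> yosida_epi A T l" "M0 - pairing p0 \<le> e"
  obtains p where "(p, pairing p) \<in> yosida_epi A T l" "dist p p0 \<le> 8 * sqrt e"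
proof (rule quasidense_imp_bronsted_rockafellar[OF closed_yosida_epi convex_yosida_epi _ _ e p0])
  show "pairing p \<le> M" if "(p, M) \<in> yosida_epi A T l" for p M
    using yosida_epi_ge_pairing[OF l NI, of "fst p" "snd p"] that by simp
  show "\<exists>q N. (q, N) \<in> yosida_epi A T l \<and> N - pairing q + (norm (fst q - fst p))\<^sup>2 / 2
      + (norm (snd q - snd p))\<^sup>2 / 2 + blinfun_apply (snd q - snd p) (fst q - fst p) \<le> e"
    if pos: "0 < e" for p e
  proof -
    obtain y y' M where "((y, y'), M) \<in> yosida_epi A T l" "M - blinfun_apply y' y + (norm (y - fst p))\<^sup>2 / 2
        + (norm (y' - snd p))\<^sup>2 / 2 + blinfun_apply (y' - snd p) (y - fst p) \<le> e"
      using yosida_epi_quasidense[OF l T NI pos] by blast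
    then show ?thesis by (intro exI[of _ "(y, y')"] exI[of _ M]) simp
  qed
qed (rule that)

subsection \<open>The duality map\<close>

text \<open>The sandwich theorem with a single point below half the squared norm: the separating
  functional is a subgradient there.\<close>

lemma norming_functional:
  fixes x :: "'a::real_normed_vector"
  obtains x' :: "'a dual" where "(norm x)\<^sup>2 / 2 + (norm x')\<^sup>2 / 2 \<le> x' x"
proof -
  have c: "convex_on UNIV (\<lambda>x::'a. (1 / 2) * (norm (id x - 0))\<^sup>2)"
    by (intro convex_on_cmul convex_on_norm_power2 linear_id) simp
  have i: "isCont (\<lambda>x::'a. (1 / 2) * (norm (id x - 0))\<^sup>2) 0"
    unfolding id_def by (intro continuous_intros)
  obtain L :: "'a dual" and \<alpha> where L: "\<And>d r. (d, r) \<in> {(x, (norm x)\<^sup>2 / 2)} \<Longrightarrow> r \<le> L d + \<alpha>"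
    "\<And>e. L e + \<alpha> \<le> (1 / 2) * (norm (id e - 0))\<^sup>2"
    using sandwich_theorem[OF c i, of "{(x, (norm x)\<^sup>2 / 2)}"] by auto
  have "\<alpha> \<le> - ((norm L)\<^sup>2 / (2 * 1))"
    by (rule norm_power2_conjugate) (use L(2) in \<open>auto simp: algebra_simps\<close>)
  with L(1)[of x "(norm x)\<^sup>2 / 2"] show ?thesis using that[of L] by simp
qed

lemma norm_canon: "norm (canon x) = norm x"
proof (rule antisym[OF norm_canon_le])
  obtain x' where "(norm x)\<^sup>2 / 2 + (norm x')\<^sup>2 / 2 \<le> blinfun_apply x' x" by (rule norming_functional)
  moreover have "canon x x' \<le> 1 * (norm (canon x))\<^sup>2 / 2 + (norm x')\<^sup>2 / (2 * 1)"
    by (rule young_blinfun[OF zero_less_one])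
  ultimately have "(norm x)\<^sup>2 \<le> (norm (canon x))\<^sup>2" unfolding canon_apply by linarith
  then show "norm x \<le> norm (canon x)" by (rule power2_le_imp_le) simp
qed

lemma duality_map_iff:
  "(y, y') \<in> duality_map \<longleftrightarrow> (norm y)\<^sup>2 / 2 + (norm y')\<^sup>2 / 2 \<le> blinfun_apply y' y"
proof
  assume "(y, y') \<in> duality_map"
  then have "(norm y)\<^sup>2 / 2 + y' (w - y) \<le> (norm w)\<^sup>2 / 2" for w by (simp add: duality_map_def subdiff_def)
  then have "(norm y)\<^sup>2 / 2 - y' y \<le> 1 * (norm w)\<^sup>2 / 2 - y' w" for w
    by (simp add: blinfun.bilinear_simps algebra_simps)
  from norm_power2_conjugate[OF zero_less_one this]
  show "(norm y)\<^sup>2 / 2 + (norm y')\<^sup>2 / 2 \<le> y' y" by simp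
next
  assume *: "(norm y)\<^sup>2 / 2 + (norm y')\<^sup>2 / 2 \<le> y' y"
  have "(norm y)\<^sup>2 / 2 + y' (w - y) \<le> (norm w)\<^sup>2 / 2" for w
    using * young_blinfun[OF zero_less_one, of y' w] by (simp add: blinfun.bilinear_simps)
  then show "(y, y') \<in> duality_map" by (simp add: duality_map_def subdiff_def)
qed

text \<open>The Bishop-Phelps theorem for the duality map: with \<open>T = {0} \<times> X*\<close> and \<open>A\<close> the identity,
  the function represented by \<^const>\<open>yosida_epi\<close> at \<open>l = 1\<close> is \<open>\<parallel>y\<parallel>\<^sup>2/2 + \<parallel>y'\<parallel>\<^sup>2/2\<close>.\<close>

lemma duality_map_range_dense:
  fixes w' :: "'a::banach dual"
  assumes \<delta>: "0 < \<delta>"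
  obtains y y' where "(y, y') \<in> duality_map" "norm (y' - w') \<le> \<delta>"
proof -
  let ?T = "{0} \<times> (UNIV :: 'a dual set)"
  have T: "monotone_op ?T" by (auto simp: monotone_op_def)
  have NI: "negative_infimum ?T" unfolding negative_infimum_def
  proof (intro allI impI)
    fix z :: "'a bidual" and x' :: "'a dual" and \<epsilon> :: real assume "0 < \<epsilon>"
    then show "\<exists>(u, u')\<in>?T. blinfun_apply (z - canon u) (x' - u') < \<epsilon>"
      by (intro bexI[of _ "(0, x')"]) auto
  qed
  have id: "x' o\<^sub>L id_blinfun = x'" for x' :: "'a dual" by (rule blinfun_eqI) simp
  have canon0: "canon 0 = (0 :: 'a bidual)" by (rule blinfun_eqI) simp
  \<comment> \<open>Chosen so that \<open>8 * sqrt e = \<delta>\<close>.\<close>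
  define e where "e = (\<delta> / 8)\<^sup>2"
  have e: "0 < e" using \<delta> by (simp add: e_def)
  obtain y0 where y0: "1 * (norm y0)\<^sup>2 / 2 - w' y0 \<le> - ((norm w')\<^sup>2 / (2 * 1)) + e"
    using norm_power2_conjugate_approx[OF zero_less_one e] by blast
  have "((y0, w' o\<^sub>L id_blinfun), 0 + (norm (0 - canon (id_blinfun y0)))\<^sup>2 / (2 * 1) + 1 * (norm w')\<^sup>2 / 2)
      \<in> yosida_epi id_blinfun ?T 1"
    by (rule yosida_epiI) auto
  then have W0: "((y0, w'), (norm y0)\<^sup>2 / 2 + (norm w')\<^sup>2 / 2) \<in> yosida_epi id_blinfun ?T 1"
    by (simp add: norm_canon id)
  have "(norm y0)\<^sup>2 / 2 + (norm w')\<^sup>2 / 2 - pairing (y0, w') \<le> e" using y0 by simp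
  then obtain p where p: "(p, pairing p) \<in> yosida_epi id_blinfun ?T 1" "dist p (y0, w') \<le> 8 * sqrt e"
    by (rule yosida_epi_bronsted_rockafellar[OF zero_less_one T NI e W0])
  obtain y y' where yy: "p = (y, y')" by (cases p)
  obtain \<zeta> x' where "y' = x' o\<^sub>L id_blinfun" and \<zeta>: "(\<zeta>, x') \<in> tilde_op ?T"
    and le: "(norm (\<zeta> - canon (id_blinfun y)))\<^sup>2 / (2 * 1) + 1 * (norm x')\<^sup>2 / 2 \<le> - blinfun_apply (\<zeta> - canon (id_blinfun y)) x'"
    by (rule yosida_epi_eq_pairing[OF zero_less_one NI p(1)[unfolded yy fst_conv snd_conv]])
  then have x': "x' = y'" by (simp add: id)
  \<comment> \<open>Since \<open>u'\<close> is arbitrary, the extension of this operator has only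
    \<open>\<zeta> = 0\<close>.\<close>
  have "0 \<le> \<zeta> (x' - u')" for u' using \<zeta> by (auto simp: tilde_op_def canon0)
  from this[of "x' + u'" for u'] this[of "x' - u'" for u'] have "\<zeta> u' = 0" for u'
    by (simp add: blinfun.bilinear_simps order_antisym)
  then have "\<zeta> = 0" by (intro blinfun_eqI) simp
  with le have "(y, y') \<in> duality_map" by (simp add: duality_map_iff x' norm_canon blinfun.bilinear_simps)
  moreover have "norm (y' - w') \<le> \<delta>"
    using dist_snd_le[of p "(y0, w')"] p(2) \<delta> by (simp add: yy e_def dist_norm)
  ultimately show ?thesis by (rule that)
qed

text \<open>Test \<open>\<zeta>\<close> against a point \<open>(y, y')\<close> of the duality map
  with \<open>y'\<close> near \<open>x' + s d\<close>. Monotonicity bounds \<open>\<zeta> d\<close>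
  by \<open>d y\<close> up to O(s), and \<open>y\<close> is a subgradient at \<open>y'\<close> of
  half the squared dual norm. The error \<open>s\<^sup>2\<close> in \<open>y'\<close> survives
  division by the step \<open>s\<close>.\<close>

lemma tilde_duality_map_subgradient:
  fixes x' :: "'a::banach dual"
  assumes J: "(\<zeta>, x') \<in> tilde_op duality_map"
  shows "(norm x')\<^sup>2 / 2 + \<zeta> d \<le> (norm (x' + d))\<^sup>2 / 2"
proof -
  \<comment> \<open>\<open>R\<close> bounds both \<open>y\<close> and \<open>y'\<close> for every
    \<open>s < 1\<close>; \<open>K\<close> collects the coefficients of \<open>s\<close> from the
    estimates 1 to 4 below.\<close>
  define R where "R = norm x' + norm d + 1"
  define K where "K = R * norm x' + \<zeta> d + norm \<zeta> + 2 * R"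
  have R: "0 \<le> R" by (simp add: R_def)
  have bound: "(norm x')\<^sup>2 / 2 + \<zeta> d \<le> (norm (x' + d))\<^sup>2 / 2 + s * K" if s: "0 < s" "s < 1" for s
  proof -
    have "0 < s\<^sup>2" using s by simp
    then obtain y y' where y: "(y, y') \<in> duality_map" and close: "norm (y' - (x' + s *\<^sub>R d)) \<le> s\<^sup>2"
      by (rule duality_map_range_dense)
    have ss: "s\<^sup>2 \<le> s" using s by (simp add: power2_eq_square mult_left_le)
    have yy: "(norm y)\<^sup>2 / 2 + (norm y')\<^sup>2 / 2 \<le> y' y" using y by (simp add: duality_map_iff)
    define g where "g = y' - (x' + s *\<^sub>R d)"
    have y': "y' = x' + s *\<^sub>R d + g" and g: "norm g \<le> s\<^sup>2" using close by (auto simp: g_def)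
    have sd: "norm (s *\<^sub>R d + g) \<le> s * norm d + s\<^sup>2"
      using norm_triangle_ineq[of "s *\<^sub>R d" g] g s by simp
    have sd1: "s * norm d \<le> norm d" using s by (simp add: mult_left_le_one_le)
    have y'R: "norm y' \<le> R"
      using norm_triangle_ineq[of x' "s *\<^sub>R d + g"] sd sd1 ss s by (simp add: y' R_def add.assoc)
    have x'y': "norm x' \<le> norm y' + s * R"
    proof -
      have "norm x' \<le> norm y' + norm (s *\<^sub>R d + g)"
        using norm_triangle_ineq4[of y' "s *\<^sub>R d + g"] by (simp add: y')
      moreover have "0 \<le> s * norm x'" using s by simp
      then have "s * norm d + s\<^sup>2 \<le> s * R" using ss by (simp add: R_def algebra_simps)
      ultimately show ?thesis using sd by linarith
    qed
    have "y' y \<le> norm y' * norm y" using norm_blinfun[of y' y] by simp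
    then have "(norm y - norm y')\<^sup>2 \<le> 0" using yy by (simp add: power2_diff algebra_simps)
    then have "norm y = norm y'" by simp
    then have yR: "norm y \<le> R" using y'R by simp
    have "0 \<le> blinfun_apply (\<zeta> - canon y) (x' - y')" using J y by (auto simp: tilde_op_def)
    then have "s * (\<zeta> d - d y) \<le> - blinfun_apply (\<zeta> - canon y) g"
      by (simp add: y' blinfun.bilinear_simps algebra_simps)
    also have "\<dots> \<le> norm (\<zeta> - canon y) * norm g" using norm_blinfun[of "\<zeta> - canon y" g] by simp
    also have "\<dots> \<le> (norm \<zeta> + R) * s\<^sup>2"
      using norm_triangle_ineq4[of \<zeta> "canon y"] yR g R by (intro mult_mono) (auto simp: norm_canon)
    finally have "s * (\<zeta> d - d y) \<le> s * ((norm \<zeta> + R) * s)" by (simp add: power2_eq_square mult_ac)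
    then have dy: "\<zeta> d - d y \<le> (norm \<zeta> + R) * s" using s by simp
    have "(1 - s) * (\<zeta> d - d y) \<le> (1 - s) * ((norm \<zeta> + R) * s)" using dy s by (intro mult_left_mono) auto
    also have "\<dots> \<le> (norm \<zeta> + R) * s" using s R by (intro mult_left_le_one_le) auto
    finally have 1: "(1 - s) * \<zeta> d - (1 - s) * d y \<le> (norm \<zeta> + R) * s" by (simp add: algebra_simps)
    \<comment> \<open>The subgradient inequality is tested at \<open>x' + d\<close>, which equals
      \<open>y' + (1 - s) d - g\<close>.\<close>
    have "(x' + d) y \<le> 1 * (norm (x' + d))\<^sup>2 / 2 + (norm y)\<^sup>2 / (2 * 1)" by (rule young_blinfun[OF zero_less_one])
    then have 2: "(norm y')\<^sup>2 / 2 + (1 - s) * d y - g y \<le> (norm (x' + d))\<^sup>2 / 2"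
      using yy by (simp add: y' blinfun.bilinear_simps algebra_simps)
    have "g y \<le> norm g * norm y" using norm_blinfun[of g y] by simp
    also have "\<dots> \<le> s * R" using g ss yR s by (intro mult_mono) auto
    finally have 3: "g y \<le> s * R" .
    have "norm x' * norm x' \<le> norm x' * (norm y' + s * R)" using x'y' by (intro mult_left_mono) auto
    moreover have "0 \<le> (norm x' - norm y')\<^sup>2" by simp
    ultimately have 4: "(norm x')\<^sup>2 / 2 - s * (R * norm x') \<le> (norm y')\<^sup>2 / 2"
      by (simp add: power2_eq_square algebra_simps)
    show ?thesis using 1 2 3 4 by (simp add: K_def algebra_simps)
  qed
  show ?thesis
  proof (rule field_le_epsilon)
    fix e :: real assume e: "0 < e"
    define s where "s = min (1 / 2) (e / (\<bar>K\<bar> + 1))"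
    have K1: "0 < \<bar>K\<bar> + 1" by simp
    have s: "0 < s" "s < 1" using e K1 by (auto simp: s_def)
    have "s \<le> e / (\<bar>K\<bar> + 1)" by (simp add: s_def)
    then have sK: "s * (\<bar>K\<bar> + 1) \<le> e" using pos_le_divide_eq[OF K1] by blast
    have "s * K \<le> s * (\<bar>K\<bar> + 1)" using s by (intro mult_left_mono) auto
    then show "(norm x')\<^sup>2 / 2 + \<zeta> d \<le> (norm (x' + d))\<^sup>2 / 2 + e" using bound[OF s] sK by linarith
  qed
qed

lemma tilde_duality_map_iff:
  fixes x' :: "'a::banach dual"
  shows "(\<zeta>, x') \<in> tilde_op duality_map \<longleftrightarrow> (norm \<zeta>)\<^sup>2 / 2 + (norm x')\<^sup>2 / 2 \<le> \<zeta> x'"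
proof
  assume J: "(\<zeta>, x') \<in> tilde_op duality_map"
  have "(norm x')\<^sup>2 / 2 - \<zeta> x' \<le> 1 * (norm w)\<^sup>2 / 2 - \<zeta> w" for w
    using tilde_duality_map_subgradient[OF J, of "w - x'"] by (simp add: blinfun.bilinear_simps)
  from norm_power2_conjugate[OF zero_less_one this]
  show "(norm \<zeta>)\<^sup>2 / 2 + (norm x')\<^sup>2 / 2 \<le> \<zeta> x'" by simp
next
  assume *: "(norm \<zeta>)\<^sup>2 / 2 + (norm x')\<^sup>2 / 2 \<le> \<zeta> x'"
  have "0 \<le> blinfun_apply (\<zeta> - canon y) (x' - y')" if "(y, y') \<in> duality_map" for y y'
    using * that[unfolded duality_map_iff] young_blinfun[OF zero_less_one, of \<zeta> y']
      young_blinfun[OF zero_less_one, of x' y] by (simp add: blinfun.bilinear_simps)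
  then show "(\<zeta>, x') \<in> tilde_op duality_map" by (auto simp: tilde_op_def)
qed

subsection \<open>Lower limits and representability\<close>

text \<open>Outside \<open>tilde_op T\<close> a negative value exists by definition. Inside, along
  the net the first factor stays bounded while the second tends to 0 in norm.\<close>

lemma type_D_imp_negative_infimum:
  assumes "type_D T"
  shows "negative_infimum T"
  unfolding negative_infimum_def
proof (intro allI impI)
  fix z x' and \<epsilon> :: real assume \<epsilon>: "0 < \<epsilon>"
  show "\<exists>(u, u') \<in> T. blinfun_apply (z - canon u) (x' - u') < \<epsilon>"
  proof (cases "(z, x') \<in> tilde_op T")
    case False
    then obtain u u' where "(u, u') \<in> T" "blinfun_apply (z - canon u) (x' - u') < 0"
      by (auto simp: tilde_op_def not_le)
    with \<epsilon> show ?thesis by (intro bexI[of _ "(u, u')"]) auto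
  next
    case True
    then obtain F B where F: "F \<noteq> bot" and ev: "eventually (\<lambda>p. p \<in> T \<and> norm (fst p) \<le> B \<and> norm (snd p) \<le> B) F"
      and lim: "(snd \<longlongrightarrow> x') F"
      using assms unfolding type_D_def by blast
    have "((\<lambda>p. (norm z + B) * norm (x' - snd p)) \<longlongrightarrow> (norm z + B) * norm (x' - x')) F"
      by (intro tendsto_intros lim)
    then have "eventually (\<lambda>p. (norm z + B) * norm (x' - snd p) < \<epsilon>) F"
      by (rule order_tendstoD(2)) (use \<epsilon> in simp)
    with ev have "eventually (\<lambda>p. p \<in> T \<and> blinfun_apply (z - canon (fst p)) (x' - snd p) < \<epsilon>) F"
    proof eventually_elim
      case (elim p)
      have "blinfun_apply (z - canon (fst p)) (x' - snd p) \<le> norm (z - canon (fst p)) * norm (x' - snd p)"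
        using norm_blinfun[of "z - canon (fst p)" "x' - snd p"] by simp
      also have "\<dots> \<le> (norm z + B) * norm (x' - snd p)"
        using elim norm_triangle_ineq4[of z "canon (fst p)"] by (intro mult_right_mono) (auto simp: norm_canon)
      finally show ?case using elim by auto
    qed
    from eventually_happens[OF this] F show ?thesis by force
  qed
qed

lemma comp_yosida_iff_yosida_epi:
  fixes A :: "'b::real_normed_vector \<Rightarrow>\<^sub>L 'a::banach"
  assumes l: "0 < l" and NI: "negative_infimum T"
  shows "(y, y') \<in> comp_op A (yosida T l) \<longleftrightarrow> ((y, y'), blinfun_apply y' y) \<in> yosida_epi A T l"
proof -
  have J: "(z, - (l *\<^sub>R x')) \<in> tilde_op duality_map \<longleftrightarrow>
      (norm z)\<^sup>2 / (2 * l) + l * (norm x')\<^sup>2 / 2 \<le> - blinfun_apply z x'" for z and x' :: "'a dual"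
  proof -
    \<comment> \<open>Multiplying by \<open>l\<close> converts the Young equality for
      \<open>- l x'\<close> into the one with parameter \<open>l\<close>.\<close>
    have "(z, - (l *\<^sub>R x')) \<in> tilde_op duality_map \<longleftrightarrow>
        l * ((norm z)\<^sup>2 / (2 * l) + l * (norm x')\<^sup>2 / 2) \<le> l * (- blinfun_apply z x')"
      unfolding tilde_duality_map_iff using l
      by (simp add: blinfun.bilinear_simps power_mult_distrib algebra_simps power2_eq_square)
    then show ?thesis unfolding mult_le_cancel_left_pos[OF l] .
  qed
  show ?thesis
  proof
    assume "(y, y') \<in> comp_op A (yosida T l)"
    then obtain x' z where y': "y' = x' o\<^sub>L A" and z: "(z, x') \<in> tilde_op T"
      and Jz: "(z - canon (A y), - (l *\<^sub>R x')) \<in> tilde_op duality_map"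
      by (auto simp: comp_op_def yosida_def)
    have "blinfun_apply z u' + blinfun_apply x' u - blinfun_apply u' u \<le> z x'" if "(u, u') \<in> T" for u u'
      using z that by (fastforce simp: tilde_op_def blinfun.bilinear_simps)
    from yosida_epiI[OF l this]
    have "((y, x' o\<^sub>L A), z x' + (norm (z - canon (A y)))\<^sup>2 / (2 * l) + l * (norm x')\<^sup>2 / 2) \<in> yosida_epi A T l" .
    then show "((y, y'), blinfun_apply y' y) \<in> yosida_epi A T l" unfolding y'
      by (rule yosida_epi_mono) (use Jz[unfolded J] in \<open>simp add: blinfun.bilinear_simps\<close>)
  next
    assume W: "((y, y'), blinfun_apply y' y) \<in> yosida_epi A T l"
    obtain \<zeta> x' where "y' = x' o\<^sub>L A" "(\<zeta>, x') \<in> tilde_op T"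
      "(norm (\<zeta> - canon (A y)))\<^sup>2 / (2 * l) + l * (norm x')\<^sup>2 / 2 \<le> - blinfun_apply (\<zeta> - canon (A y)) x'"
      by (rule yosida_epi_eq_pairing[OF l NI W])
    then show "(y, y') \<in> comp_op A (yosida T l)"
      by (auto simp: comp_op_def yosida_def J)
  qed
qed

section \<open>Painleve-Kuratowski lower limits of sets\<close>

definition inner_limit :: "(nat \<Rightarrow> 'c::metric_space set) \<Rightarrow> 'c set" where
  "inner_limit W = {x. \<exists>xs. (\<forall>n. xs n \<in> W n) \<and> xs \<longlonglongrightarrow> x}"

text \<open>Distances reduce closedness to a triangle inequality, without diagonal sequences.
  Nonempty sets matter because \<open>infdist\<close> to the empty set is 0.\<close>

lemma inner_limit_eq_infdist:
  assumes ne: "\<And>n. W n \<noteq> {}"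
  shows "inner_limit W = {x. (\<lambda>n. infdist x (W n)) \<longlonglongrightarrow> 0}"
proof (intro equalityI subsetI CollectI)
  fix x assume "x \<in> inner_limit W"
  then obtain xs where xs: "\<And>n. xs n \<in> W n" "xs \<longlonglongrightarrow> x" by (auto simp: inner_limit_def)
  have "(\<lambda>n. dist x (xs n)) \<longlonglongrightarrow> dist x x" by (intro tendsto_intros xs)
  then have lim: "(\<lambda>n. dist x (xs n)) \<longlonglongrightarrow> 0" by simp
  show "(\<lambda>n. infdist x (W n)) \<longlonglongrightarrow> 0"
    by (rule tendsto_sandwich[OF _ _ tendsto_const lim]) (simp_all add: infdist_nonneg infdist_le xs(1))
next
  fix x assume "x \<in> {x. (\<lambda>n. infdist x (W n)) \<longlonglongrightarrow> 0}"
  then have lim: "(\<lambda>n. infdist x (W n) + 1 / real (Suc n)) \<longlonglongrightarrow> 0 + 0"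
    by (intro tendsto_add LIMSEQ_Suc[OF lim_1_over_n]) simp
  have "\<exists>w\<in>W n. dist x w < infdist x (W n) + 1 / real (Suc n)" for n
  proof (rule ccontr)
    assume "\<not> ?thesis"
    then have "infdist x (W n) + 1 / real (Suc n) \<le> infdist x (W n)"
      unfolding infdist_notempty[OF ne] by (intro cINF_greatest[OF ne]) (auto simp: not_less)
    then show False by (simp add: field_simps)
  qed
  then obtain xs where xs: "\<And>n. xs n \<in> W n" "\<And>n. dist x (xs n) < infdist x (W n) + 1 / real (Suc n)"
    by metis
  have "(\<lambda>n. dist (xs n) x) \<longlonglongrightarrow> 0"
  proof (rule tendsto_sandwich[OF _ _ tendsto_const])
    show "(\<lambda>n. infdist x (W n) + 1 / real (Suc n)) \<longlonglongrightarrow> 0" using lim by simp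
    show "\<forall>\<^sub>F n in sequentially. dist (xs n) x \<le> infdist x (W n) + 1 / real (Suc n)"
      using xs(2) by (intro always_eventually allI) (metis dist_commute less_imp_le)
  qed simp
  then have "xs \<longlonglongrightarrow> x" by (rule tendsto_dist_iff[THEN iffD2])
  with xs(1) show "x \<in> inner_limit W" by (auto simp: inner_limit_def)
qed

lemma closed_inner_limit:
  assumes ne: "\<And>n. W n \<noteq> {}"
  shows "closed (inner_limit W)"
  unfolding closed_sequential_limits
proof (intro allI impI, elim conjE)
  fix f x assume f: "\<forall>k. f k \<in> inner_limit W" "f \<longlonglongrightarrow> x"
  have "(\<lambda>n. infdist x (W n)) \<longlonglongrightarrow> 0"
  proof (rule LIMSEQ_I)
    fix e :: real assume e: "0 < e"
    obtain k where k: "dist (f k) x < e / 2"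
      using metric_LIMSEQ_D[OF f(2), of "e / 2"] e by auto
    have "(\<lambda>n. infdist (f k) (W n)) \<longlonglongrightarrow> 0" using f(1) by (auto simp: inner_limit_eq_infdist[OF ne])
    from LIMSEQ_D[OF this, of "e / 2"] e obtain N where N: "\<And>n. n \<ge> N \<Longrightarrow> infdist (f k) (W n) < e / 2"
      by (auto simp: infdist_nonneg)
    have "infdist x (W n) < e" if "n \<ge> N" for n
      using infdist_triangle[of x "W n" "f k"] N[OF that] k by (simp add: dist_commute)
    then show "\<exists>N. \<forall>n\<ge>N. norm (infdist x (W n) - 0) < e" by (auto simp: infdist_nonneg)
  qed
  then show "x \<in> inner_limit W" by (simp add: inner_limit_eq_infdist[OF ne])
qed

lemma convex_inner_limit:
  fixes W :: "nat \<Rightarrow> 'c::real_normed_vector set"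
  assumes "\<And>n. convex (W n)"
  shows "convex (inner_limit W)"
proof (rule convexI)
  fix x y and s t :: real
  assume "x \<in> inner_limit W" "y \<in> inner_limit W" and st: "0 \<le> s" "0 \<le> t" "s + t = 1"
  then obtain xs ys where "\<And>n. xs n \<in> W n" "xs \<longlonglongrightarrow> x" "\<And>n. ys n \<in> W n" "ys \<longlonglongrightarrow> y"
    by (auto simp: inner_limit_def)
  then have "\<And>n. s *\<^sub>R xs n + t *\<^sub>R ys n \<in> W n" "(\<lambda>n. s *\<^sub>R xs n + t *\<^sub>R ys n) \<longlonglongrightarrow> s *\<^sub>R x + t *\<^sub>R y"
    using assms st by (auto intro!: convexD tendsto_intros)
  then show "s *\<^sub>R x + t *\<^sub>R y \<in> inner_limit W" unfolding inner_limit_def mem_Collect_eq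
    by (intro exI[of _ "\<lambda>n. s *\<^sub>R xs n + t *\<^sub>R ys n"]) simp
qed

section \<open>Representing functions from epigraphs\<close>

text \<open>Treated apart because the intersection of the epigraphs could then be empty, whereas a
  representing function must be proper. The summand 1 keeps \<open>g\<close> strictly above the
  pairing.\<close>

lemma representable_empty: "representable ({} :: ('b::real_normed_vector \<times> 'b dual) set)"
proof -
  define g where "g p = (1 / 2) * (norm (fst p - 0))\<^sup>2 + (1 / 2) * (norm (snd p - 0))\<^sup>2 + 1" for p :: "'b \<times> 'b dual"
  have g: "convex_on UNIV g" unfolding g_def[abs_def]
    by (intro convex_on_add convex_on_cmul convex_on_norm_power2 linear_fst linear_snd)
      (auto simp: convex_on_def simp flip: distrib_right)
  have "ereal_convex (\<lambda>p. ereal (g p))" unfolding ereal_convex_def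
  proof (intro allI impI)
    fix u v and t :: real assume "0 \<le> t \<and> t \<le> 1"
    then show "ereal (g (t *\<^sub>R u + (1 - t) *\<^sub>R v)) \<le> ereal t * ereal (g u) + ereal (1 - t) * ereal (g v)"
      using convex_onD[OF g, of "1 - t" u v] by simp
  qed
  moreover have "lsc_ereal (\<lambda>p. ereal (g p))"
    unfolding lsc_ereal_def ereal_less_eq(3) g_def
    by (intro allI closed_Collect_le continuous_intros)
  moreover have lt: "blinfun_apply y' y < g (y, y')" for y y'
    using young_blinfun[OF zero_less_one, of y' y] by (simp add: g_def)
  moreover have "ereal (blinfun_apply y' y) \<le> ereal (g (y, y'))" for y y' using lt[of y' y] by simp
  moreover have "g (y, y') \<noteq> blinfun_apply y' y" for y y' using lt[of y' y] by simp
  then have "{} = {(y, y'). ereal (g (y, y')) = ereal (blinfun_apply y' y)}"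
    by auto
  ultimately show ?thesis unfolding representable_def
    by (intro exI[of _ "\<lambda>p. ereal (g p)"]) auto
qed

text \<open>Closedness and upward closure make each fibre of \<open>W\<close> a closed ray or empty,
  so the sublevel sets of the fibrewise infimum are exactly the sections of
  \<open>W\<close>.\<close>

lemma representable_if_epigraph:
  fixes W :: "(('b::real_normed_vector \<times> 'b dual) \<times> real) set"
  assumes W: "closed W" "convex W" "W \<noteq> {}"
    and up: "\<And>p M N. (p, M) \<in> W \<Longrightarrow> M \<le> N \<Longrightarrow> (p, N) \<in> W"
    and ge: "\<And>p M. (p, M) \<in> W \<Longrightarrow> pairing p \<le> M"
  shows "representable {p. (p, pairing p) \<in> W}"
proof -
  define h where "h p = Inf (ereal ` {M. (p, M) \<in> W})" for p
  have le: "h p \<le> ereal c \<longleftrightarrow> (p, c) \<in> W" for p c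
  proof
    assume "(p, c) \<in> W"
    then show "h p \<le> ereal c" unfolding h_def by (intro Inf_lower) auto
  next
    assume hc: "h p \<le> ereal c"
    have "(p, c + 1 / real (Suc n)) \<in> W" for n
    proof -
      have "h p < ereal (c + 1 / real (Suc n))" using hc by (rule le_less_trans) simp
      then obtain M where "(p, M) \<in> W" "M < c + 1 / real (Suc n)" unfolding h_def Inf_less_iff by auto
      then show ?thesis by (meson up less_imp_le)
    qed
    moreover have "(\<lambda>n. (p, c + 1 / real (Suc n))) \<longlonglongrightarrow> (p, c + 0)"
      by (intro tendsto_intros LIMSEQ_Suc[OF lim_1_over_n])
    ultimately have "(p, c + 0) \<in> W" by (rule closed_sequentially[OF W(1)])
    then show "(p, c) \<in> W" by simp
  qed
  have hge: "ereal (pairing p) \<le> h p" for p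
    unfolding h_def by (intro Inf_greatest) (auto dest: ge)
  have ninf: "h p \<noteq> -\<infinity>" for p using hge[of p] by auto
  obtain p0 M0 where "(p0, M0) \<in> W" using W(3) by auto
  then have proper: "\<exists>p. h p \<noteq> \<infinity>" using le[of p0 M0] by (intro exI[of _ p0]) auto
  have "lsc_ereal h" unfolding lsc_ereal_def
  proof
    fix c :: real
    have "closed ((\<lambda>p. (p, c)) -` W)" by (intro closed_vimage W(1) continuous_intros)
    then show "closed {p. h p \<le> ereal c}" by (simp add: le vimage_def)
  qed
  moreover have "ereal_convex h" unfolding ereal_convex_def
  proof (intro allI impI)
    fix u v and t :: real assume t: "0 \<le> t \<and> t \<le> 1"
    \<comment> \<open>The endpoints are separate because zero times infinity is zero in
      \<open>ereal\<close>.\<close>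
    consider "t = 0" | "t = 1" | "0 < t" "t < 1" using t by linarith
    then show "h (t *\<^sub>R u + (1 - t) *\<^sub>R v) \<le> ereal t * h u + ereal (1 - t) * h v"
    proof cases
      case 3
      show ?thesis
      proof (cases "h u = \<infinity> \<or> h v = \<infinity>")
        case True
        then have "ereal t * h u + ereal (1 - t) * h v = \<infinity>"
          using 3 ninf[of u] ninf[of v] by (cases "h u"; cases "h v") auto
        then show ?thesis by (metis ereal_less_eq(1))
      next
        case False
        then obtain a b where ab: "h u = ereal a" "h v = ereal b"
          using ninf[of u] ninf[of v] by (cases "h u"; cases "h v") auto
        then have "(u, a) \<in> W" "(v, b) \<in> W" using le[of u a] le[of v b] by auto
        from convexD[OF W(2) this, of t "1 - t"] t
        have "(t *\<^sub>R u + (1 - t) *\<^sub>R v, t * a + (1 - t) * b) \<in> W" by simp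
        then show ?thesis using le ab by auto
      qed
    qed (simp_all flip: zero_ereal_def one_ereal_def)
  qed
  moreover have "{p. (p, pairing p) \<in> W} = {(y, y'). h (y, y') = ereal (blinfun_apply y' y)}"
  proof -
    have "(p, pairing p) \<in> W \<longleftrightarrow> h p = ereal (pairing p)" for p
      unfolding le[symmetric] using hge[of p] by (auto intro: antisym)
    then show ?thesis by auto
  qed
  moreover have "ereal (blinfun_apply y' y) \<le> h (y, y')" for y y' using hge[of "(y, y')"] by simp
  ultimately show ?thesis unfolding representable_def using ninf proper by blast
qed

lemma liminf_comp_yosida_iff:
  fixes A :: "'b::banach \<Rightarrow>\<^sub>L 'a::banach"
  assumes T: "monotone_op T" and NI: "negative_infimum T" and l: "\<And>n. 0 < l n"
  shows "p \<in> liminf_op (\<lambda>n. comp_op A (yosida T (l n))) \<longleftrightarrow>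
    (p, pairing p) \<in> inner_limit (\<lambda>n. yosida_epi A T (l n))"
proof
  assume "p \<in> liminf_op (\<lambda>n. comp_op A (yosida T (l n)))"
  then obtain ys ys' where ys: "\<forall>n. (ys n, ys' n) \<in> comp_op A (yosida T (l n))"
    and lim: "ys \<longlonglongrightarrow> fst p" "ys' \<longlonglongrightarrow> snd p"
    by (auto simp: liminf_op_def)
  have "((ys n, ys' n), blinfun_apply (ys' n) (ys n)) \<in> yosida_epi A T (l n)" for n
    using ys comp_yosida_iff_yosida_epi[OF l NI] by blast
  moreover have "(\<lambda>n. ((ys n, ys' n), blinfun_apply (ys' n) (ys n))) \<longlonglongrightarrow> ((fst p, snd p), pairing p)"
    by (intro tendsto_intros lim)
  ultimately show "(p, pairing p) \<in> inner_limit (\<lambda>n. yosida_epi A T (l n))"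
    unfolding inner_limit_def mem_Collect_eq prod.collapse
    by (intro exI[of _ "\<lambda>n. ((ys n, ys' n), blinfun_apply (ys' n) (ys n))"]) simp
next
  assume "(p, pairing p) \<in> inner_limit (\<lambda>n. yosida_epi A T (l n))"
  then obtain xs where xs: "\<And>n. xs n \<in> yosida_epi A T (l n)" and lim: "xs \<longlonglongrightarrow> (p, pairing p)"
    unfolding inner_limit_def by blast
  have ps: "(\<lambda>n. fst (xs n)) \<longlonglongrightarrow> p" and Ms: "(\<lambda>n. snd (xs n)) \<longlonglongrightarrow> pairing p"
    using tendsto_fst[OF lim] tendsto_snd[OF lim] by simp_all
  \<comment> \<open>The summand \<open>1 / (n + 1)\<close> makes the defect strictly positive, as
    the Broensted-Rockafellar property demands.\<close>
  define e where "e n = snd (xs n) - pairing (fst (xs n)) + 1 / real (Suc n)" for n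
  have ge: "pairing (fst (xs n)) \<le> snd (xs n)" for n
    by (rule yosida_epi_ge_pairing[OF l NI]) (use xs[of n] in simp)
  have "e \<longlonglongrightarrow> pairing p - pairing p + 0" unfolding e_def
    by (intro tendsto_add tendsto_diff Ms LIMSEQ_Suc[OF lim_1_over_n] tendsto_intros ps)
  then have e0: "e \<longlonglongrightarrow> 0" by simp
  have "\<exists>q. (q, pairing q) \<in> yosida_epi A T (l n) \<and> dist q (fst (xs n)) \<le> 8 * sqrt (e n)" for n
  proof -
    have epos: "0 < e n" using ge[of n] by (simp add: e_def add_nonneg_pos)
    have W: "(fst (xs n), snd (xs n)) \<in> yosida_epi A T (l n)" using xs[of n] by simp
    have "snd (xs n) - pairing (fst (xs n)) \<le> e n" by (simp add: e_def)
    from yosida_epi_bronsted_rockafellar[OF l T NI epos W this] show ?thesis by blast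
  qed
  then obtain q where q: "\<And>n. (q n, pairing (q n)) \<in> yosida_epi A T (l n)"
    "\<And>n. dist (q n) (fst (xs n)) \<le> 8 * sqrt (e n)" by metis
  have "(\<lambda>n. 8 * sqrt (e n) + dist (fst (xs n)) p) \<longlonglongrightarrow> 8 * sqrt 0 + dist p p"
    by (intro tendsto_intros e0 ps)
  then have lim0: "(\<lambda>n. 8 * sqrt (e n) + dist (fst (xs n)) p) \<longlonglongrightarrow> 0" by simp
  have "(\<lambda>n. dist (q n) p) \<longlonglongrightarrow> 0"
  proof (rule tendsto_sandwich[OF _ _ tendsto_const lim0])
    show "\<forall>\<^sub>F n in sequentially. dist (q n) p \<le> 8 * sqrt (e n) + dist (fst (xs n)) p"
      using q(2) dist_triangle[of "q n" p "fst (xs n)" for n]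
      by (intro always_eventually allI) (meson add_right_mono order_trans)
  qed simp
  then have qp: "q \<longlonglongrightarrow> p" by (rule tendsto_dist_iff[THEN iffD2])
  have "(fst (q n), snd (q n)) \<in> comp_op A (yosida T (l n))" for n
    unfolding comp_yosida_iff_yosida_epi[OF l NI] using q(1)[of n] by simp
  then show "p \<in> liminf_op (\<lambda>n. comp_op A (yosida T (l n)))"
    using tendsto_fst[OF qp] tendsto_snd[OF qp] unfolding liminf_op_def
    by (cases p) (auto intro!: exI[of _ "\<lambda>n. fst (q n)"] exI[of _ "\<lambda>n. snd (q n)"])
qed

theorem theorem4p4:
  fixes T :: "('a::banach \<times> 'a dual) set"
    and A :: "'b::banach \<Rightarrow>\<^sub>L 'a"
  assumes "type_D T"
  shows "representable (var_comp A T)"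
proof (cases "var_comp A T = {}")
  case True
  then show ?thesis by (simp add: representable_empty)
next
  case False
  have T: "monotone_op T" using assms by (simp add: type_D_def maximal_monotone_def)
  have NI: "negative_infimum T" by (rule type_D_imp_negative_infimum[OF assms])
  define \<J> where "\<J> = {l :: nat \<Rightarrow> real. (\<forall>n. 0 < l n) \<and> l \<longlonglongrightarrow> 0}"
  define V where "V l = inner_limit (\<lambda>n. yosida_epi A T (l n))" for l
  define W where "W = (\<Inter>l\<in>\<J>. V l)"
  have "p \<in> var_comp A T \<longleftrightarrow> (\<forall>l\<in>\<J>. p \<in> liminf_op (\<lambda>n. comp_op A (yosida T (l n))))" for p
    unfolding var_comp_def \<J>_def by blast
  also have "\<dots> p \<longleftrightarrow> (\<forall>l\<in>\<J>. (p, pairing p) \<in> V l)" for p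
    unfolding V_def by (intro ball_cong refl liminf_comp_yosida_iff T NI) (simp add: \<J>_def)
  finally have eq: "var_comp A T = {p. (p, pairing p) \<in> W}" by (auto simp: W_def)
  have ne: "yosida_epi A T c \<noteq> {}" if "0 < c" for c
    using yosida_epi_quasidense[OF that T NI zero_less_one] by blast
  have "representable {p. (p, pairing p) \<in> W}"
  proof (rule representable_if_epigraph)
    show "closed W" unfolding W_def V_def \<J>_def by (intro closed_INT ballI closed_inner_limit ne) simp
    show "convex W" unfolding W_def V_def by (intro convex_INT convex_inner_limit convex_yosida_epi)
    show "W \<noteq> {}" using False eq by auto
  next
    fix p M N assume "(p, M) \<in> W" "M \<le> N"
    show "(p, N) \<in> W" unfolding W_def
    proof
      fix l assume "l \<in> \<J>"
      then obtain xs where xs: "\<And>n. xs n \<in> yosida_epi A T (l n)" "xs \<longlonglongrightarrow> (p, M)"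
        using \<open>(p, M) \<in> W\<close> unfolding W_def V_def inner_limit_def by blast
      have "(fst (xs n), snd (xs n) + (N - M)) \<in> yosida_epi A T (l n)" for n
        by (rule yosida_epi_mono[of _ "snd (xs n)"]) (use xs(1) \<open>M \<le> N\<close> in auto)
      moreover have "(\<lambda>n. (fst (xs n), snd (xs n) + (N - M))) \<longlonglongrightarrow> (fst (p, M), snd (p, M) + (N - M))"
        by (intro tendsto_intros xs(2))
      ultimately show "(p, N) \<in> V l" unfolding V_def inner_limit_def mem_Collect_eq
        by (intro exI[of _ "\<lambda>n. (fst (xs n), snd (xs n) + (N - M))"]) simp
    qed
  next
    fix p M assume pW: "(p, M) \<in> W"
    \<comment> \<open>One explicit sequence is enough: membership in a single \<open>V l\<close>
      already forces the lower bound.\<close>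
    have J: "(\<lambda>n. 1 / real (Suc n)) \<in> \<J>" unfolding \<J>_def
      using LIMSEQ_Suc[OF lim_1_over_n] by simp
    then obtain xs where xs: "\<And>n. xs n \<in> yosida_epi A T (1 / real (Suc n))" "xs \<longlonglongrightarrow> (p, M)"
      using pW unfolding W_def V_def inner_limit_def by blast
    have "pairing (fst (xs n)) \<le> snd (xs n)" for n
      by (rule yosida_epi_ge_pairing[of "1 / real (Suc n)", OF _ NI]) (use xs(1)[of n] in auto)
    moreover have "(\<lambda>n. pairing (fst (xs n))) \<longlonglongrightarrow> pairing (fst (p, M))"
      by (intro tendsto_intros xs(2))
    moreover have "(\<lambda>n. snd (xs n)) \<longlonglongrightarrow> snd (p, M)" by (intro tendsto_intros xs(2))
    ultimately show "pairing p \<le> M" using LIMSEQ_le by fastforce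
  qed
  then show ?thesis by (simp add: eq)
qed

end
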